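(* Let $\mathbf{A}\in\mathbb{R}^{m\times n}$, $\mathbf{b}\in\mathbb{R}^m$, $\mathbf{c}\in\mathbb{R}^n$, $\eta\in(0,1/\|\mathbf{A}\|_2)$. Consider one phase of PDHG with PDHG basis $(B,N)$ and initial point $(\mathbf{x}^{(0)},\mathbf{y}^{(0)})$, and let $\mathbf{P}_B$, the spiral center $(\mathbf{x}_{\mathbf{v}},\mathbf{y}_{\mathbf{v}})$ and the ray direction $\mathbf{v}=(\mathbf{v}_{\mathbf{x}},\mathbf{v}_{\mathbf{y}})$ be as defined in the context. Then: (1) The rotation improves primal and dual feasibility by approaching the spiral center, which has least-squares primal and dual error; that is, $$\lim_{k\to\infty}\mathbf{P}_B^k\begin{bmatrix}\mathbf{x}_B^{(0)}-(\mathbf{x}_{\mathbf{v}})_B\\ \mathbf{y}^{(0)}-\mathbf{y}_{\mathbf{v}}\end{bmatrix}=\mathbf{0},$$ $(\mathbf{x}_{\mathbf{v}})_B$ minimizes $\|\mathbf{A}_B\mathbf{x}_B-\mathbf{b}\|_2$ over $\mathbf{x}_B\in\mathbb{R}^{|B|}$, and $\mathbf{y}_{\mathbf{v}}$ minimizes $\|\mathbf{A}_B^\top\mathbf{y}-\mathbf{c}_B\|_2$ over $\mathbf{y}\in\mathbb{R}^m$. (2) The duality gap $\mathbf{c}^\top\mathbf{x}-\mathbf{b}^\top\mathbf{y}$ is monotonically nonincreasing along the spiral ray $(\mathbf{x}_{\mathbf{v}},\mathbf{y}_{\mathbf{v}})+\theta\mathbf{v}$, $\theta\ge 0$, i.e.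 $\mathbf{c}^\top\mathbf{v}_{\mathbf{x}}-\mathbf{b}^\top\mathbf{v}_{\mathbf{y}}\le 0$. Furthermore, if $\mathbf{v}\ne\mathbf{0}$, then the decay is strict: $\mathbf{c}^\top\mathbf{v}_{\mathbf{x}}-\mathbf{b}^\top\mathbf{v}_{\mathbf{y}}<0$.
   Context: The LP is $\min\{\mathbf{c}^\top\mathbf{x}:\mathbf{A}\mathbf{x}=\mathbf{b},\ \mathbf{x}\ge\mathbf{0}\}$, with dual $\max\{\mathbf{b}^\top\mathbf{y}:\mathbf{A}^\top\mathbf{y}\le\mathbf{c}\}$. PDHG with step size $\eta$ starts from a point in $\mathbb{R}^n_+\times\mathbb{R}^m$ and iterates $\mathbf{x}^{(k+1)}=\mathrm{Proj}_{\mathbb{R}^n_+}(\mathbf{x}^{(k)}-\eta(\mathbf{c}-\mathbf{A}^\top\mathbf{y}^{(k)}))$, $\mathbf{y}^{(k+1)}=\mathbf{y}^{(k)}+\eta(\mathbf{b}-\mathbf{A}(2\mathbf{x}^{(k+1)}-\mathbf{x}^{(k)}))$. Notation: $\mathbf{A}_i$ is the $i$-th column of $\mathbf{A}$; for an index set $J$, $\mathbf{A}_J$ is the submatrix of columns indexed by $J$ and $\mathbf{x}_J$ the corresponding subvector; $\|\mathbf{A}\|_2$ is the spectral norm; $^\dagger$ is the Moore–Penrose inverse; $\mathrm{Proj}_S$ is Euclidean projection onto $S$. PDHG basis of an iterate $(\mathbf{x},\mathbf{y})$: $B=\{i:\mathbf{x}_i>0\}\cup\{i:\mathbf{x}_i=0,\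 \mathbf{c}_i-\mathbf{A}_i^\top\mathbf{y}\le 0\}$, $N=\{i:\mathbf{x}_i=0,\ \mathbf{c}_i-\mathbf{A}_i^\top\mathbf{y}>0\}$. A phase is a sequence of consecutive PDHG iterates sharing the same PDHG basis; its first iterate is its initial point. For a phase with basis $(B,N)$ and initial point $(\mathbf{x}^{(0)},\mathbf{y}^{(0)})$: $$\mathbf{P}_B=\begin{bmatrix}\mathbf{I}_{|B|} & \eta\mathbf{A}_B^\top\\ -\eta\mathbf{A}_B & \mathbf{I}_m-2\eta^2\mathbf{A}_B\mathbf{A}_B^\top\end{bmatrix};$$ spiral center: $(\mathbf{x}_{\mathbf{v}})_B=(\mathbf{A}_B^\top\mathbf{A}_B)^\dagger\mathbf{A}_B^\top\mathbf{b}+\mathrm{Proj}_{\{\mathbf{x}:\mathbf{A}_B\mathbf{x}=\mathbf{0}\}}(\mathbf{x}_B^{(0)})$, $(\mathbf{x}_{\mathbf{v}})_N=\mathbf{0}$, $\mathbf{y}_{\mathbf{v}}=(\mathbf{A}_B\mathbf{A}_B^\top)^\dagger\mathbf{A}_B\mathbf{c}_B+\mathrm{Proj}_{\{\mathbf{y}:\mathbf{A}_B^\top\mathbf{y}=\mathbf{0}\}}(\mathbf{y}^{(0)})$; ray direction: $(\mathbf{v}_{\mathbf{x}})_B=-\eta[\mathbf{c}_B-\mathbf{A}_B^\top(\mathbf{A}_B\mathbf{A}_B^\top)^\dagger\mathbf{A}_B\mathbf{c}_B]$, $(\mathbf{v}_{\mathbf{x}})_N=\mathbf{0}$, $\mathbf{v}_{\mathbf{y}}=\eta[\mathbf{b}-\mathbf{A}_B(\mathbf{A}_B^\top\mathbf{A}_B)^\dagger\mathbf{A}_B^\top\mathbf{b}]$.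 The rotation component after $k$ steps is $\mathbf{P}_B^k$ (the $k$-th power) applied to $(\mathbf{x}_B^{(0)}-(\mathbf{x}_{\mathbf{v}})_B,\ \mathbf{y}^{(0)}-\mathbf{y}_{\mathbf{v}})$; the forward movement after $k$ steps is $k\mathbf{v}$. *)

theory Defs
  imports
    Complex_Main
    "HOL-Library.Extended_Nat"
    "Jordan_Normal_Form.DL_Submatrix"
    "Jordan_Normal_Form.Matrix_Kernel"
begin

definition l2_norm :: "real vec \<Rightarrow> real" where
  "l2_norm v = sqrt (v \<bullet> v)"

definition spectral_norm :: "real mat \<Rightarrow> real" where
  "spectral_norm A = (SUP v \<in> {v \<in> carrier_vec (dim_col A). l2_norm v \<le> 1}. l2_norm (A *\<^sub>v v))"

definition proj :: "real vec set \<Rightarrow> real vec \<Rightarrow> real vec" where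
  "proj S v = (THE p. p \<in> S \<and> (\<forall>q\<in>S. l2_norm (v - p) \<le> l2_norm (v - q)))"

text \<open>The four Penrose conditions; they determine \<open>X\<close> uniquely (lemma \<open>pinv_eqI\<close> below).\<close>

definition is_pinv :: "real mat \<Rightarrow> real mat \<Rightarrow> bool" where
  "is_pinv A X \<longleftrightarrow>
     X \<in> carrier_mat (dim_col A) (dim_row A) \<and>
     A * X * A = A \<and> X * A * X = X \<and>
     (A * X)\<^sup>T = A * X \<and> (X * A)\<^sup>T = X * A"

definition pinv :: "real mat \<Rightarrow> real mat" where
  "pinv A = (THE X. is_pinv A X)"

text \<open>Coordinates are numbered from 0. In \<open>sub_vec\<close> and \<open>sub_cols\<close> the indices in \<open>J\<close> are
  renumbered increasingly, \<open>pick J k\<close> being the \<open>k\<close>-th smallest element of \<open>J\<close>.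
  \<open>extend_vec\<close> is the inverse renumbering, with value 0 outside \<open>J\<close>.\<close>

definition sub_vec :: "real vec \<Rightarrow> nat set \<Rightarrow> real vec" where
  "sub_vec v J = vec (card {i. i < dim_vec v \<and> i \<in> J}) (\<lambda>k. v $ pick J k)"

abbreviation sub_cols :: "real mat \<Rightarrow> nat set \<Rightarrow> real mat" where
  "sub_cols A J \<equiv> submatrix A UNIV J"

definition extend_vec :: "nat \<Rightarrow> nat set \<Rightarrow> real vec \<Rightarrow> real vec" where
  "extend_vec n J w = vec n (\<lambda>i. if i \<in> J then w $ card {j \<in> J. j < i} else 0)"

definition nonneg_orthant :: "nat \<Rightarrow> real vec set" where
  "nonneg_orthant n = {x \<in> carrier_vec n. \<forall>i<n. 0 \<le> x $ i}"

definition pdhg_step ::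
  "real mat \<Rightarrow> real vec \<Rightarrow> real vec \<Rightarrow> real \<Rightarrow> real vec \<times> real vec \<Rightarrow> real vec \<times> real vec" where
  "pdhg_step A b c \<eta> = (\<lambda>(x, y).
     let x' = proj (nonneg_orthant (dim_col A)) (x - \<eta> \<cdot>\<^sub>v (c - A\<^sup>T *\<^sub>v y))
     in (x', y + \<eta> \<cdot>\<^sub>v (b - A *\<^sub>v (2 \<cdot>\<^sub>v x' - x))))"

definition pdhg_iterates ::
  "real mat \<Rightarrow> real vec \<Rightarrow> real vec \<Rightarrow> real \<Rightarrow> (nat \<Rightarrow> real vec \<times> real vec) \<Rightarrow> bool" where
  "pdhg_iterates A b c \<eta> z \<longleftrightarrow>
     z 0 \<in> nonneg_orthant (dim_col A) \<times> carrier_vec (dim_row A) \<and>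
     (\<forall>k. z (Suc k) = pdhg_step A b c \<eta> (z k))"

definition pdhg_basis ::
  "real mat \<Rightarrow> real vec \<Rightarrow> real vec \<times> real vec \<Rightarrow> nat set \<times> nat set" where
  "pdhg_basis A c = (\<lambda>(x, y).
     ({i. i < dim_col A \<and> x $ i > 0} \<union>
      {i. i < dim_col A \<and> x $ i = 0 \<and> c $ i - col A i \<bullet> y \<le> 0},
      {i. i < dim_col A \<and> x $ i = 0 \<and> c $ i - col A i \<bullet> y > 0}))"

text \<open>The phase consists of the iterates \<open>z k\<close> with \<open>s \<le> k < e\<close>; it is infinite if \<open>e = \<infinity>\<close>.
  It need not be maximal.\<close>

definition pdhg_phase ::
  "real mat \<Rightarrow> real vec \<Rightarrow> real vec \<Rightarrow> real \<Rightarrow> nat set \<Rightarrow> nat set \<Rightarrow>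
   (nat \<Rightarrow> real vec \<times> real vec) \<Rightarrow> nat \<Rightarrow> enat \<Rightarrow> bool" where
  "pdhg_phase A b c \<eta> B N z s e \<longleftrightarrow>
     pdhg_iterates A b c \<eta> z \<and> enat s < e \<and>
     (\<forall>k. s \<le> k \<and> enat k < e \<longrightarrow> pdhg_basis A c (z k) = (B, N))"

text \<open>In a phase with basis \<open>(B, N)\<close> the set \<open>N\<close> is the complement of \<open>B\<close> in \<open>{0..<dim_col A}\<close>,
  so \<open>extend_vec\<close> makes exactly the \<open>N\<close>-coordinates vanish.\<close>

definition P_mat :: "real mat \<Rightarrow> real \<Rightarrow> nat set \<Rightarrow> real mat" where
  "P_mat A \<eta> B = (let A_B = sub_cols A B in
     four_block_mat
       (1\<^sub>m (dim_col A_B))  (\<eta> \<cdot>\<^sub>m A_B\<^sup>T)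
       (- (\<eta> \<cdot>\<^sub>m A_B))      (1\<^sub>m (dim_row A_B) - (2 * \<eta>\<^sup>2) \<cdot>\<^sub>m (A_B * A_B\<^sup>T)))"

definition center_x :: "real mat \<Rightarrow> real vec \<Rightarrow> nat set \<Rightarrow> real vec \<Rightarrow> real vec" where
  "center_x A b B x0 = (let A_B = sub_cols A B in
     extend_vec (dim_col A) B
       (pinv (A_B\<^sup>T * A_B) *\<^sub>v (A_B\<^sup>T *\<^sub>v b) + proj (mat_kernel A_B) (sub_vec x0 B)))"

definition center_y :: "real mat \<Rightarrow> real vec \<Rightarrow> nat set \<Rightarrow> real vec \<Rightarrow> real vec" where
  "center_y A c B y0 = (let A_B = sub_cols A B in
     pinv (A_B * A_B\<^sup>T) *\<^sub>v (A_B *\<^sub>v sub_vec c B) + proj (mat_kernel (A_B\<^sup>T)) y0)"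

definition ray_x :: "real mat \<Rightarrow> real vec \<Rightarrow> real \<Rightarrow> nat set \<Rightarrow> real vec" where
  "ray_x A c \<eta> B = (let A_B = sub_cols A B; c_B = sub_vec c B in
     extend_vec (dim_col A) B
       (- (\<eta> \<cdot>\<^sub>v (c_B - A_B\<^sup>T *\<^sub>v (pinv (A_B * A_B\<^sup>T) *\<^sub>v (A_B *\<^sub>v c_B))))))"

definition ray_y :: "real mat \<Rightarrow> real vec \<Rightarrow> real \<Rightarrow> nat set \<Rightarrow> real vec" where
  "ray_y A b \<eta> B = (let A_B = sub_cols A B in
     \<eta> \<cdot>\<^sub>v (b - A_B *\<^sub>v (pinv (A_B\<^sup>T * A_B) *\<^sub>v (A_B\<^sup>T *\<^sub>v b))))"

definition duality_gap :: "real vec \<Rightarrow> real vec \<Rightarrow> real vec \<Rightarrow> real vec \<Rightarrow> real" where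
  "duality_gap b c x y = c \<bullet> x - b \<bullet> y"

lemma pinv_eqI:
  assumes "is_pinv A X"
  shows "pinv A = X"
  unfolding pinv_def
proof (rule the_equality)
  show "is_pinv A X" by (fact assms)
next
  fix Y assume Y: "is_pinv A Y"
  obtain r c where A: "A \<in> carrier_mat r c" by (metis carrier_matI)
  have Xc: "X \<in> carrier_mat c r" and Yc: "Y \<in> carrier_mat c r"
    using assms Y A unfolding is_pinv_def by auto
  have X: "A * X * A = A" "X * A * X = X" "(A * X)\<^sup>T = A * X" "(X * A)\<^sup>T = X * A"
    using assms unfolding is_pinv_def by auto
  have Y': "A * Y * A = A" "Y * A * Y = Y" "(A * Y)\<^sup>T = A * Y" "(Y * A)\<^sup>T = Y * A"
    using Y unfolding is_pinv_def by auto
  note [simp] = A Xc Yc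
  have [simp]: "A * X \<in> carrier_mat r r" "A * Y \<in> carrier_mat r r"
    "X * A \<in> carrier_mat c c" "Y * A \<in> carrier_mat c c"
    using A Xc Yc mult_carrier_mat by blast+
  have AX: "A * X = A * Y"
  proof -
    have "(A * X)\<^sup>T = ((A * Y) * (A * X))\<^sup>T"
      using assoc_mult_mat[of "A * Y" r r A c X r] Y'(1) by simp
    also have "\<dots> = (A * X) * (A * Y)"
      using transpose_mult[of "A * Y" r r "A * X" r] X(3) Y'(3) by simp
    also have "\<dots> = A * Y"
      using assoc_mult_mat[of "A * X" r r A c Y r] X(1) by simp
    finally show ?thesis using X(3) by simp
  qed
  have XA: "X * A = Y * A"
  proof -
    have "(X * A)\<^sup>T = ((X * A) * (Y * A))\<^sup>T"
      using assoc_mult_mat[of X c r A c "Y * A" c] assoc_mult_mat[of A r c Y r A c] Y'(1) by simp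
    also have "\<dots> = (Y * A) * (X * A)"
      using transpose_mult[of "X * A" c c "Y * A" c] X(4) Y'(4) by simp
    also have "\<dots> = Y * A"
      using assoc_mult_mat[of Y c r A c "X * A" c] assoc_mult_mat[of A r c X r A c] X(1) by simp
    finally show ?thesis using X(4) by simp
  qed
  have "Y = Y * A * Y" using Y' by simp
  also have "\<dots> = X * A * X"
    using assoc_mult_mat[of X c r A c Y r] assoc_mult_mat[of X c r A c X r] AX XA by simp
  finally show "Y = X" using X by simp
qed

lemma sub_vec_extend_vec:
  assumes "w \<in> carrier_vec (card {i. i < n \<and> i \<in> J})"
  shows "sub_vec (extend_vec n J w) J = w"
proof (rule eq_vecI)
  show "dim_vec (sub_vec (extend_vec n J w) J) = dim_vec w"
    using assms by (simp add: sub_vec_def extend_vec_def)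
next
  fix k assume "k < dim_vec w"
  hence k: "k < card {i. i < n \<and> i \<in> J}" using assms by simp
  have "pick J k < n" using k by (rule pick_le)
  moreover have "pick J k \<in> J"
    using k by (metis (mono_tags, lifting) mem_Collect_eq pick_in_set_le pick_reduce_set)
  moreover have "card {j \<in> J. j < pick J k} = k"
  proof (cases "finite J")
    case True
    have "card {i. i < n \<and> i \<in> J} \<le> card J" by (rule card_mono) (auto simp: True)
    thus ?thesis using k card_pick[of k J] by auto
  next
    case False
    thus ?thesis using card_pick[of k J] by auto
  qed
  ultimately show "sub_vec (extend_vec n J w) J $ k = w $ k"
    using k by (simp add: sub_vec_def extend_vec_def)
qed

lemma proj_nonneg_orthant:
  assumes v: "v \<in> carrier_vec n"
  shows "proj (nonneg_orthant n) v = vec n (\<lambda>i. max 0 (v $ i))"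
proof -
  let ?p = "vec n (\<lambda>i. max 0 (v $ i))"
  have sq: "(v - q) \<bullet> (v - q) = (\<Sum>i<n. (v $ i - q $ i)\<^sup>2)" if "q \<in> carrier_vec n" for q
    using that v by (auto simp: scalar_prod_def power2_eq_square atLeast0LessThan intro!: sum.cong)
  have p: "?p \<in> nonneg_orthant n" by (auto simp: nonneg_orthant_def)
  have le: "(v $ i - ?p $ i)\<^sup>2 \<le> (v $ i - q $ i)\<^sup>2"
    if "q \<in> nonneg_orthant n" "i < n" for q i
  proof (cases "v $ i \<ge> 0")
    case False
    moreover have "q $ i \<ge> 0" using that by (simp add: nonneg_orthant_def)
    ultimately show ?thesis using that by (auto simp: abs_le_square_iff[symmetric])
  qed (use that in auto)
  have min: "l2_norm (v - ?p) \<le> l2_norm (v - q)" if "q \<in> nonneg_orthant n" for q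
  proof -
    have "q \<in> carrier_vec n" using that by (simp add: nonneg_orthant_def)
    thus ?thesis unfolding l2_norm_def
      using le[OF that] by (subst sq, simp)+ (auto intro!: sum_mono)
  qed
  show ?thesis unfolding proj_def
  proof (rule the_equality)
    show "?p \<in> nonneg_orthant n \<and> (\<forall>q\<in>nonneg_orthant n. l2_norm (v - ?p) \<le> l2_norm (v - q))"
      using p min by blast
  next
    fix q assume q: "q \<in> nonneg_orthant n \<and>
      (\<forall>r\<in>nonneg_orthant n. l2_norm (v - q) \<le> l2_norm (v - r))"
    hence qc: "q \<in> carrier_vec n" by (simp add: nonneg_orthant_def)
    have "l2_norm (v - q) \<le> l2_norm (v - ?p)" using q p by blast
    hence "(\<Sum>i<n. (v $ i - q $ i)\<^sup>2) \<le> (\<Sum>i<n. (v $ i - ?p $ i)\<^sup>2)"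
      unfolding l2_norm_def real_sqrt_le_iff using sq[OF qc] sq[of ?p] by simp
    moreover have "(v $ i - ?p $ i)\<^sup>2 \<le> (v $ i - q $ i)\<^sup>2" if "i < n" for i
      using le q that by blast
    ultimately have "\<forall>i\<in>{..<n}. (v $ i - q $ i)\<^sup>2 - (v $ i - ?p $ i)\<^sup>2 = 0"
      by (subst sum_nonneg_eq_0_iff[symmetric])
         (auto simp: sum_subtractf intro!: antisym sum_mono)
    hence eq: "(v $ i - q $ i)\<^sup>2 = (v $ i - max 0 (v $ i))\<^sup>2" if "i < n" for i
      using that by simp
    show "q = ?p"
    proof (rule eq_vecI)
      fix i assume "i < dim_vec ?p"
      hence i: "i < n" by simp
      moreover have "q $ i \<ge> 0" using i q by (simp add: nonneg_orthant_def)
      ultimately show "q $ i = ?p $ i"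
        using eq[OF i] by (auto simp: power2_eq_iff max_def split: if_splits)
    qed (use qc in simp)
  qed
qed

end

theory Submission
  imports Defs
begin

text \<open>
  Write \<open>K\<close> for \<open>A_B\<close> and \<open>K\<^sup>\<dagger>\<close> for its Moore--Penrose inverse. Since
  \<open>(K\<^sup>TK)\<^sup>\<dagger>K\<^sup>T = K\<^sup>\<dagger>\<close> and the projection of \<open>v\<close> onto the kernel of \<open>K\<close> is \<open>v - K\<^sup>\<dagger>Kv\<close>, the
  initial deviation from the spiral center is \<open>K\<^sup>\<dagger>(Kx - b)\<close> in the primal and \<open>(K\<^sup>T)\<^sup>\<dagger>(K\<^sup>Ty - c_B)\<close>
  in the dual part; it lies in the ranges of \<open>K\<^sup>T\<close> and \<open>K\<close>, which the rotation preserves.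
  With \<open>L = \<eta>K\<close> and \<open>d = L\<^sup>Ty\<close>, one rotation step lowers the energy
  \<open>|x|\<^sup>2 + |y|\<^sup>2 + 2\<langle>y, Lx\<rangle>\<close>, which is nonnegative as \<open>|L| < 1\<close>, by
  \<open>(|d|\<^sup>2 - |Ld|\<^sup>2) + |L(x + d)|\<^sup>2\<close>. Hence \<open>L\<^sup>Ty\<close> and \<open>Lx\<close> tend to 0, and so do \<open>x\<close> and \<open>y\<close>,
  because \<open>L\<^sup>\<dagger>L\<close> and \<open>(L\<^sup>T)\<^sup>\<dagger>L\<^sup>T\<close> fix them. The slope of the duality gap along the ray is
  \<open>-\<eta>\<close> times the sum of the squared primal and dual least-squares residuals.
\<close>

section \<open>Existence of the Moore--Penrose inverse\<close>

lemma scalar_self_eq_0_iff: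
  fixes v :: "real vec"
  shows "v \<bullet> v = 0 \<longleftrightarrow> v = 0\<^sub>v (dim_vec v)"
proof
  assume "v \<bullet> v = 0"
  then have "\<forall>i\<in>{0..<dim_vec v}. v $ i * v $ i = 0"
    unfolding scalar_prod_def by (subst (asm) sum_nonneg_eq_0_iff) auto
  then show "v = 0\<^sub>v (dim_vec v)" by (intro eq_vecI) auto
qed (metis carrier_vec_dim_vec scalar_prod_left_zero)

lemma scalar_self_nonneg: "0 \<le> v \<bullet> v" for v :: "real vec"
  unfolding scalar_prod_def by (intro sum_nonneg) auto

lemma l2_norm_nonneg: "0 \<le> l2_norm v"
  by (simp add: l2_norm_def scalar_self_nonneg)

lemma l2_norm_sq: "(l2_norm v)\<^sup>2 = v \<bullet> v"
  by (simp add: l2_norm_def scalar_self_nonneg)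

lemma l2_norm_le_iff: "l2_norm u \<le> l2_norm v \<longleftrightarrow> u \<bullet> u \<le> v \<bullet> v"
  by (simp add: l2_norm_def)

lemma vec_eq_of_minus_eq_0:
  fixes u v :: "real vec"
  assumes "u \<in> carrier_vec n" "v \<in> carrier_vec n" "u - v = 0\<^sub>v n"
  shows "u = v"
proof (rule eq_vecI)
  fix i assume "i < dim_vec v"
  then show "u $ i = v $ i" using assms(1,2) arg_cong[OF assms(3), of "\<lambda>w. w $ i"] by simp
qed (use assms in simp)

lemma scalar_self_add:
  fixes u v :: "real vec"
  assumes "u \<in> carrier_vec n" "v \<in> carrier_vec n"
  shows "(u + v) \<bullet> (u + v) = u \<bullet> u + 2 * (u \<bullet> v) + v \<bullet> v"
  using assms comm_scalar_prod[of u n v]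
  by (simp add: add_scalar_prod_distrib[of _ n] scalar_prod_add_distrib[of _ n])

lemma mult_transpose_scalar:
  fixes A :: "real mat"
  assumes "A \<in> carrier_mat m n" "x \<in> carrier_vec n" "y \<in> carrier_vec m"
  shows "(A\<^sup>T *\<^sub>v y) \<bullet> x = y \<bullet> (A *\<^sub>v x)"
  using assms by (rule transpose_vec_mult_scalar)

lemma mult_mat_unit_vec:
  fixes A :: "real mat"
  assumes "A \<in> carrier_mat m n" "j < n"
  shows "A *\<^sub>v unit_vec n j = col A j"
  using assms by (intro eq_vecI) auto

text \<open>By induction on the number of columns that \<open>A * X\<close> fixes: if the next
  column \<open>a\<close> leaves a nonzero residual \<open>r\<close>, a rank-one correction of
  \<open>X\<close> repairs it without disturbing the earlier columns.\<close>

lemma exists_generalized_inverse: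
  fixes A :: "real mat"
  assumes A: "A \<in> carrier_mat m n"
  shows "\<exists>X \<in> carrier_mat n m. A * X * A = A"
proof -
  have "\<exists>X \<in> carrier_mat n m. \<forall>j<k. A *\<^sub>v (X *\<^sub>v col A j) = col A j" if "k \<le> n" for k
    using that
  proof (induction k)
    case 0
    have "0\<^sub>m n m \<in> carrier_mat n m" by simp
    then show ?case by blast
  next
    case (Suc k)
    then obtain X where X: "X \<in> carrier_mat n m"
      and fix_cols: "\<And>j. j < k \<Longrightarrow> A *\<^sub>v (X *\<^sub>v col A j) = col A j" by auto
    define a where "a = col A k"
    have a: "a \<in> carrier_vec m" using A by (intro carrier_vecI) (simp add: a_def)
    have AXv: "A *\<^sub>v (X *\<^sub>v v) \<in> carrier_vec m" for v using A by (intro carrier_vecI) simp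
    define r where "r = a - A *\<^sub>v (X *\<^sub>v a)"
    have r: "r \<in> carrier_vec m" using a A by (intro carrier_vecI) (simp add: r_def)
    show ?case
    proof (cases "r = 0\<^sub>v m")
      case True
      then have "A *\<^sub>v (X *\<^sub>v a) = a"
        using vec_eq_of_minus_eq_0[OF a AXv[of a]] by (simp add: r_def)
      then show ?thesis using fix_cols X by (auto simp: less_Suc_eq a_def)
    next
      case False
      then have rr: "r \<bullet> r \<noteq> 0" using scalar_self_eq_0_iff[of r] r by auto
      \<comment> \<open>\<open>u\<close> is what \<open>X *\<^sub>v a\<close> lacks to be the
        obvious preimage \<open>unit_vec n k\<close> of \<open>a\<close>; hence \<open>A\<close>
        maps it to \<open>r\<close>.\<close>
      define u where "u = unit_vec n k - X *\<^sub>v a"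
      have u: "u \<in> carrier_vec n" using X a by (auto simp: u_def)
      have Au: "A *\<^sub>v u = r"
        using A X a Suc.prems
        by (simp add: u_def r_def a_def mult_minus_distrib_mat_vec[of _ m n] mult_mat_unit_vec)
      \<comment> \<open>The functional \<open>w\<close> vanishes on the columns treated before and takes the value 1 at \<open>a\<close>.\<close>
      define w where "w = (1 / (r \<bullet> r)) \<cdot>\<^sub>v (r - (A * X)\<^sup>T *\<^sub>v r)"
      have w: "w \<in> carrier_vec m" using X by (intro carrier_vecI) (simp add: w_def)
      have w_scalar: "w \<bullet> v = (r \<bullet> (v - A *\<^sub>v (X *\<^sub>v v))) / (r \<bullet> r)" if v: "v \<in> carrier_vec m" for v
      proof -
        have "(A * X)\<^sup>T *\<^sub>v r \<in> carrier_vec m" using X by (intro carrier_vecI) simp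
        then have "w \<bullet> v = (r \<bullet> v - ((A * X)\<^sup>T *\<^sub>v r) \<bullet> v) / (r \<bullet> r)"
          using r v unfolding w_def
          by (subst smult_scalar_prod_distrib[of _ m]) (auto simp: minus_scalar_prod_distrib[of _ m])
        also have "((A * X)\<^sup>T *\<^sub>v r) \<bullet> v = r \<bullet> (A *\<^sub>v (X *\<^sub>v v))"
          using A X r v by (subst mult_transpose_scalar[of _ m m]) auto
        finally show ?thesis
          using r v AXv by (simp add: scalar_prod_minus_distrib[of _ m])
      qed
      \<comment> \<open>The outer product of \<open>u\<close> and \<open>w\<close> adds nothing on
        vectors annihilated by \<open>w\<close> and adds exactly the missing \<open>u\<close> at
        \<open>a\<close>.\<close>
      define X' where "X' = X + mat n m (\<lambda>(i, j). u $ i * w $ j)"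
      have X': "X' \<in> carrier_mat n m" using X by (simp add: X'_def)
      have X'v: "X' *\<^sub>v v = X *\<^sub>v v + (w \<bullet> v) \<cdot>\<^sub>v u" if v: "v \<in> carrier_vec m" for v
      proof -
        have "mat n m (\<lambda>(i, j). u $ i * w $ j) *\<^sub>v v = (w \<bullet> v) \<cdot>\<^sub>v u"
        proof (rule eq_vecI)
          fix i assume "i < dim_vec ((w \<bullet> v) \<cdot>\<^sub>v u)"
          then have "i < n" using u by auto
          then show "(mat n m (\<lambda>(i, j). u $ i * w $ j) *\<^sub>v v) $ i = ((w \<bullet> v) \<cdot>\<^sub>v u) $ i"
            using u v by (simp add: scalar_prod_def sum_distrib_left mult_ac)
        qed (use u in simp)
        then show ?thesis using X v by (simp add: X'_def add_mult_distrib_mat_vec[of _ n m])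
      qed
      have AX'v: "A *\<^sub>v (X' *\<^sub>v v) = A *\<^sub>v (X *\<^sub>v v) + (w \<bullet> v) \<cdot>\<^sub>v r" if v: "v \<in> carrier_vec m" for v
        using A X u v by (simp add: X'v mult_add_distrib_mat_vec[of _ m n] mult_mat_vec[of _ m n] Au)
      have "A *\<^sub>v (X' *\<^sub>v col A j) = col A j" if "j < Suc k" for j
      proof (cases "j = k")
        case True
        have "w \<bullet> a = 1" using rr a by (simp add: w_scalar r_def[symmetric])
        then have "A *\<^sub>v (X' *\<^sub>v a) = A *\<^sub>v (X *\<^sub>v a) + r" using AX'v[OF a] r by simp
        also have "\<dots> = a" using a A by (intro eq_vecI) (auto simp: r_def)
        finally show ?thesis using True by (simp add: a_def)
      next
        case False
        then have j: "j < k" using that by simp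
        then have aj: "col A j \<in> carrier_vec m" using A by auto
        then have "w \<bullet> col A j = 0" using j r by (simp add: w_scalar fix_cols)
        then show ?thesis using AX'v[OF aj] j by (simp add: fix_cols) (use A r in \<open>auto intro!: eq_vecI\<close>)
      qed
      then show ?thesis using X' by blast
    qed
  qed
  then obtain X where X: "X \<in> carrier_mat n m"
    and cols: "\<And>j. j < n \<Longrightarrow> A *\<^sub>v (X *\<^sub>v col A j) = col A j" by blast
  have "A * X * A = A"
  proof (rule mat_col_eqI)
    fix j assume j: "j < dim_col A"
    then have "col (A * X * A) j = A * X *\<^sub>v col A j" using A X by (intro col_mult2) auto
    also have "\<dots> = col A j" using A X j cols[of j] by (subst assoc_mult_mat_vec) auto
    finally show "col (A * X * A) j = col A j" .
  qed (use A X in auto)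
  then show ?thesis using X by blast
qed

text \<open>Dimension equations take the place of carrier premises, so that rewriting need not guess
  the intermediate dimensions.\<close>

lemma mult_mat_assoc_dim:
  fixes A B C :: "real mat"
  assumes "dim_col A = dim_row B" "dim_col B = dim_row C"
  shows "A * B * C = A * (B * C)"
  using assms by (intro assoc_mult_mat) auto

lemma mult_mat_vec_assoc_dim:
  fixes A B :: "real mat"
  assumes "dim_col A = dim_row B" "dim_col B = dim_vec v"
  shows "A * B *\<^sub>v v = A *\<^sub>v (B *\<^sub>v v)"
  using assms by (intro assoc_mult_mat_vec) (auto intro: carrier_vecI)

text \<open>The inner product of \<open>A\<^sup>T *\<^sub>v (A *\<^sub>v x)\<close> with
  \<open>x\<close> is the squared norm of \<open>A *\<^sub>v x\<close>. This permits cancelling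
  \<open>A\<^sup>T\<close> on the left.\<close>

lemma gram_eq_0_imp_eq_0:
  fixes A :: "real mat"
  assumes A: "A \<in> carrier_mat m n" and x: "x \<in> carrier_vec n" and 0: "A\<^sup>T *\<^sub>v (A *\<^sub>v x) = 0\<^sub>v n"
  shows "A *\<^sub>v x = 0\<^sub>v m"
proof -
  have "(A *\<^sub>v x) \<bullet> (A *\<^sub>v x) = (A\<^sup>T *\<^sub>v (A *\<^sub>v x)) \<bullet> x"
    using A x by (subst mult_transpose_scalar[of _ m n]) auto
  then show ?thesis using A x scalar_self_eq_0_iff[of "A *\<^sub>v x"] by (simp add: 0)
qed

text \<open>Any generalized inverse \<open>W\<close> of the Gram matrix \<open>G\<close> serves,
  with \<open>X = W * A\<^sup>T\<close>: cancelling \<open>A\<^sup>T\<close> in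
  \<open>G * W * G = G\<close> yields the first equation, and this in turn makes
  \<open>A * X\<close> symmetric even if \<open>W\<close> is not.\<close>

lemma exists_least_squares_inverse:
  fixes A :: "real mat"
  assumes A: "A \<in> carrier_mat m n"
  shows "\<exists>X \<in> carrier_mat n m. A * X * A = A \<and> (A * X)\<^sup>T = A * X"
proof -
  have At: "A\<^sup>T \<in> carrier_mat n m" using A by simp
  define G where "G = A\<^sup>T * A"
  have G: "G \<in> carrier_mat n n" using A by (simp add: G_def)
  obtain W where W: "W \<in> carrier_mat n n" and GWG: "G * W * G = G"
    using exists_generalized_inverse[OF G] by auto
  define X where "X = W * A\<^sup>T"
  have X: "X \<in> carrier_mat n m" using A W by (simp add: X_def)
  have AXA: "A * X * A = A"
  proof (rule mat_col_eqI)
    fix j assume "j < dim_col A"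
    then have j: "j < n" using A by simp
    \<comment> \<open>\<open>v\<close> is column \<open>j\<close> of \<open>X * A\<close> minus the
      identity; the aim is that \<open>A\<close> annihilates it.\<close>
    define v where "v = X *\<^sub>v col A j - unit_vec n j"
    have v: "v \<in> carrier_vec n" using A by (intro carrier_vecI) (simp add: v_def)
    have "A\<^sup>T *\<^sub>v (A *\<^sub>v (X *\<^sub>v col A j)) = A\<^sup>T *\<^sub>v col A j"
    proof -
      have ej: "unit_vec n j \<in> carrier_vec n" by simp
      have "A\<^sup>T *\<^sub>v (A *\<^sub>v (X *\<^sub>v col A j)) = G *\<^sub>v (W *\<^sub>v (G *\<^sub>v unit_vec n j))"
        using A At W j ej by (simp add: X_def G_def mult_mat_unit_vec[OF A j])
      also have "\<dots> = G * W * G *\<^sub>v unit_vec n j"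
        using G W by (simp add: mult_mat_assoc_dim mult_mat_vec_assoc_dim)
      also have "\<dots> = A\<^sup>T *\<^sub>v col A j"
        unfolding GWG using A At j by (simp add: G_def mult_mat_unit_vec[OF A j])
      finally show ?thesis .
    qed
    then have "A\<^sup>T *\<^sub>v (A *\<^sub>v v) = 0\<^sub>v n"
      using A X j
      by (simp add: v_def mult_minus_distrib_mat_vec[of _ m n] mult_minus_distrib_mat_vec[of _ n m]
          mult_mat_unit_vec[OF A j])
    then have "A *\<^sub>v v = 0\<^sub>v m" using gram_eq_0_imp_eq_0[OF A v] by simp
    then have eq: "A *\<^sub>v (X *\<^sub>v col A j) - col A j = 0\<^sub>v m"
      using A X j by (simp add: v_def mult_minus_distrib_mat_vec[of _ m n] mult_mat_unit_vec[OF A j])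
    have "A *\<^sub>v (X *\<^sub>v col A j) = col A j"
      by (rule vec_eq_of_minus_eq_0[OF _ _ eq]) (use A in \<open>simp_all add: carrier_dim_vec\<close>)
    then show "col (A * X * A) j = col A j"
      using A X j by (subst col_mult2[of "A * X" m m A n]) auto
  qed (use A X in auto)
  have Xt: "X\<^sup>T = A * W\<^sup>T" using A W by (simp add: X_def transpose_mult[of W n n "A\<^sup>T" m])
  have AtAX: "A\<^sup>T * (X\<^sup>T * A\<^sup>T) = A\<^sup>T"
  proof -
    have "(A * X * A)\<^sup>T = A\<^sup>T * (A * X)\<^sup>T"
      using A X by (intro transpose_mult) auto
    also have "(A * X)\<^sup>T = X\<^sup>T * A\<^sup>T" using A X by (rule transpose_mult)
    finally show ?thesis by (simp only: AXA)
  qed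
  \<comment> \<open>Inserting \<open>A = A * X * A\<close> into the transpose
    \<open>A * W\<^sup>T * A\<^sup>T\<close> exposes a factor that \<open>AtAX\<close> collapses to
    \<open>A\<^sup>T\<close>; this removes \<open>W\<^sup>T\<close> and leaves
    \<open>A * W * A\<^sup>T\<close>.\<close>
  have "(A * X)\<^sup>T = X\<^sup>T * A\<^sup>T" using A X by (rule transpose_mult)
  also have "\<dots> = A * W\<^sup>T * A\<^sup>T" by (simp add: Xt)
  also have "\<dots> = (A * X * A) * W\<^sup>T * A\<^sup>T" by (simp add: AXA)
  also have "\<dots> = A * W * (A\<^sup>T * (X\<^sup>T * A\<^sup>T))"
    unfolding Xt using A W by (simp add: X_def mult_mat_assoc_dim)
  also have "\<dots> = A * X" unfolding AtAX using A At W by (simp add: X_def mult_mat_assoc_dim)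
  finally show ?thesis using X AXA by blast
qed

text \<open>Uniqueness is \<open>pinv_eqI\<close>. For existence, \<open>X\<close> makes
  \<open>A * X\<close> symmetric, and transposing a least-squares inverse of
  \<open>A\<^sup>T\<close> gives \<open>Y\<close> with \<open>Y * A\<close> symmetric. The matrix
  \<open>Y * A * X\<close> has the products \<open>A * X\<close> and \<open>Y * A\<close> with
  \<open>A\<close>, so it inherits both symmetries.\<close>

lemma is_pinv_pinv: "is_pinv A (pinv A)"
proof -
  define m where "m = dim_row A"
  define n where "n = dim_col A"
  have A: "A \<in> carrier_mat m n" by (simp add: m_def n_def)
  obtain X where X: "X \<in> carrier_mat n m" "A * X * A = A" "(A * X)\<^sup>T = A * X"
    using exists_least_squares_inverse[OF A] by blast
  have At: "A\<^sup>T \<in> carrier_mat n m" using A by simp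
  obtain Z where Z: "Z \<in> carrier_mat m n" "A\<^sup>T * Z * A\<^sup>T = A\<^sup>T" "(A\<^sup>T * Z)\<^sup>T = A\<^sup>T * Z"
    using exists_least_squares_inverse[OF At] by blast
  define Y where "Y = Z\<^sup>T"
  have Y: "Y \<in> carrier_mat n m" using Z by (simp add: Y_def)
  have YA: "Y * A = A\<^sup>T * Z" using Z A by (simp add: Y_def transpose_mult[of _ n m _ n])
  then have YAt: "(Y * A)\<^sup>T = Y * A" using Z by simp
  have AYA: "A * Y * A = A"
  proof -
    have "A = (A\<^sup>T * Z * A\<^sup>T)\<^sup>T" by (simp only: Z(2) transpose_transpose)
    also have "\<dots> = A * (A\<^sup>T * Z)\<^sup>T"
      using transpose_mult[of "A\<^sup>T * Z" n n "A\<^sup>T" m] At Z(1) by auto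
    also have "\<dots> = A * Y * A"
      unfolding Z(3) unfolding YA[symmetric] using A Y by simp
    finally show ?thesis by simp
  qed
  have AXA': "A * (X * A) = A"
    using X(1,2) A by (simp add: assoc_mult_mat[of A m n X m A n])
  have AYAX: "A * (Y * (A * X)) = A * X"
  proof -
    have "A * (Y * (A * X)) = A * Y * A * X"
      using A X(1) Y by (simp add: mult_mat_assoc_dim)
    then show ?thesis by (simp only: AYA)
  qed
  have "is_pinv A (Y * A * X)"
  proof -
    have carrier: "Y * A * X \<in> carrier_mat n m" using A X(1) Y by auto
    have AP: "A * (Y * A * X) = A * X" using AYAX A X(1) Y by (simp add: mult_mat_assoc_dim)
    have PA: "Y * A * X * A = Y * A" using AXA' A X(1) Y by (simp add: mult_mat_assoc_dim)
    have PAP: "Y * A * (Y * A * X) = Y * A * X" using AYAX A X(1) Y by (simp add: mult_mat_assoc_dim)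
    show ?thesis
      unfolding is_pinv_def AP PA PAP X(2,3) YAt using carrier by (simp add: m_def n_def)
  qed
  then show ?thesis using pinv_eqI by metis
qed

section \<open>Projections and least squares\<close>

lemma is_pinv_transpose:
  assumes "is_pinv A X"
  shows "is_pinv A\<^sup>T X\<^sup>T"
proof -
  obtain m n where A: "A \<in> carrier_mat m n" by (metis carrier_matI)
  have X: "X \<in> carrier_mat n m" using assms A by (auto simp: is_pinv_def)
  have p: "A * X * A = A" "X * A * X = X" "(A * X)\<^sup>T = A * X" "(X * A)\<^sup>T = X * A"
    using assms by (auto simp: is_pinv_def)
  have AX: "A\<^sup>T * X\<^sup>T = X * A" using transpose_mult[OF X A] p by simp
  have XA: "X\<^sup>T * A\<^sup>T = A * X" using transpose_mult[OF A X] p by simp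
  have "A\<^sup>T * X\<^sup>T * A\<^sup>T = (A * X * A)\<^sup>T"
    using A X by (simp add: transpose_mult[of _ m n _ n] transpose_mult[of _ n m _ n])
  moreover have "X\<^sup>T * A\<^sup>T * X\<^sup>T = (X * A * X)\<^sup>T"
    using A X by (simp add: transpose_mult[of _ n m _ m] transpose_mult[of _ m n _ m])
  ultimately show ?thesis
    using A X AX XA p by (auto simp: is_pinv_def)
qed

lemma pinv_carrier: "A \<in> carrier_mat m n \<Longrightarrow> pinv A \<in> carrier_mat n m"
  using is_pinv_pinv[of A] by (auto simp: is_pinv_def)

text \<open>The last two identities exchange the symmetric matrix \<open>A * pinv A\<close> with its
  transpose and then apply a Penrose condition; they are what the normal equations need.\<close>

lemma pinv_props:
  assumes "A \<in> carrier_mat m n"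
  shows "A * pinv A * A = A" "pinv A * A * pinv A = pinv A"
    "(pinv A)\<^sup>T * A\<^sup>T = A * pinv A" "A\<^sup>T * (pinv A)\<^sup>T = pinv A * A"
    "A\<^sup>T * A * pinv A = A\<^sup>T" "pinv A * (pinv A)\<^sup>T * A\<^sup>T = pinv A"
proof -
  note X = pinv_carrier[OF assms]
  have At: "A\<^sup>T \<in> carrier_mat n m" and Xt: "(pinv A)\<^sup>T \<in> carrier_mat m n" using assms X by auto
  show p: "A * pinv A * A = A" "pinv A * A * pinv A = pinv A"
    "(pinv A)\<^sup>T * A\<^sup>T = A * pinv A" "A\<^sup>T * (pinv A)\<^sup>T = pinv A * A"
    using is_pinv_pinv[of A] transpose_mult[OF X assms] transpose_mult[OF assms X]
    by (auto simp: is_pinv_def)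
  have "A\<^sup>T * A * pinv A = A\<^sup>T * ((pinv A)\<^sup>T * A\<^sup>T)"
    using assms At X by (simp add: p assoc_mult_mat[of _ n m _ n _ m])
  also have "\<dots> = A\<^sup>T"
    using is_pinv_transpose[OF is_pinv_pinv[of A]] At Xt
    by (simp add: is_pinv_def assoc_mult_mat[of _ n m _ n _ m])
  finally show "A\<^sup>T * A * pinv A = A\<^sup>T" .
  have "pinv A * (pinv A)\<^sup>T * A\<^sup>T = pinv A * (A * pinv A)"
    using assms At X Xt by (simp add: p assoc_mult_mat[of _ n m _ n _ m])
  also have "\<dots> = pinv A"
    using p(2) assms X by (simp add: mult_mat_assoc_dim)
  finally show "pinv A * (pinv A)\<^sup>T * A\<^sup>T = pinv A" .
qed

text \<open>With \<open>X = pinv A\<close>, the products of \<open>A\<^sup>T * A\<close> and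
  \<open>X * X\<^sup>T\<close> in either order equal the symmetric projector \<open>X * A\<close>,
  which fixes both matrices when multiplied from the left.\<close>

lemma pinv_gram:
  assumes A: "A \<in> carrier_mat m n"
  shows "pinv (A\<^sup>T * A) = pinv A * (pinv A)\<^sup>T"
proof (rule pinv_eqI)
  define X where "X = pinv A"
  have X: "X \<in> carrier_mat n m" using A by (simp add: X_def pinv_carrier)
  have At: "A\<^sup>T \<in> carrier_mat n m" and Xt: "X\<^sup>T \<in> carrier_mat m n" using A X by auto
  note p = pinv_props[OF A, folded X_def]
  have GX: "A\<^sup>T * A * (X * X\<^sup>T) = X * A"
  proof -
    have "A\<^sup>T * A * (X * X\<^sup>T) = A\<^sup>T * A * X * X\<^sup>T"
      using A At X Xt by (intro assoc_mult_mat[symmetric, of _ n n _ m _ n]) auto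
    then show ?thesis by (simp add: p)
  qed
  have XG: "X * X\<^sup>T * (A\<^sup>T * A) = X * A"
  proof -
    have "X * X\<^sup>T * (A\<^sup>T * A) = X * X\<^sup>T * A\<^sup>T * A"
      using A At X Xt by (intro assoc_mult_mat[symmetric, of _ n n _ m _ n]) auto
    then show ?thesis by (simp add: p)
  qed
  have 1: "X * A * (A\<^sup>T * A) = A\<^sup>T * A"
  proof -
    have "X * A * (A\<^sup>T * A) = A\<^sup>T * X\<^sup>T * A\<^sup>T * A"
      unfolding p(4)[symmetric] using A At X Xt by (intro assoc_mult_mat[symmetric, of _ n n _ m _ n]) auto
    also have "A\<^sup>T * X\<^sup>T * A\<^sup>T = A\<^sup>T"
      using is_pinv_transpose[OF is_pinv_pinv[of A]] by (simp add: is_pinv_def X_def)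
    finally show ?thesis .
  qed
  have 2: "X * A * (X * X\<^sup>T) = X * X\<^sup>T"
  proof -
    have "X * A * (X * X\<^sup>T) = X * A * X * X\<^sup>T"
      using A At X Xt by (intro assoc_mult_mat[symmetric, of _ n n _ m _ n]) auto
    then show ?thesis by (simp only: p)
  qed
  have sym: "(X * A)\<^sup>T = X * A" using transpose_mult[OF X A] p(4) by simp
  show "is_pinv (A\<^sup>T * A) (pinv A * (pinv A)\<^sup>T)"
    unfolding is_pinv_def X_def[symmetric] GX XG 1 2 sym using A X by auto
qed

text \<open>Turns the Gram-matrix formulas of the spiral center and the ray into expressions in
  \<open>pinv A\<close> alone.\<close>

lemma pinv_normal_equations:
  assumes A: "A \<in> carrier_mat m n" and b: "b \<in> carrier_vec m"
  shows "pinv (A\<^sup>T * A) *\<^sub>v (A\<^sup>T *\<^sub>v b) = pinv A *\<^sub>v b"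
proof -
  note X = pinv_carrier[OF A]
  have "pinv (A\<^sup>T * A) *\<^sub>v (A\<^sup>T *\<^sub>v b) = pinv A * (pinv A)\<^sup>T * A\<^sup>T *\<^sub>v b"
    unfolding pinv_gram[OF A] using A X b by (intro assoc_mult_mat_vec[symmetric, of _ n n _ m]) auto
  then show ?thesis by (simp only: pinv_props[OF A])
qed

text \<open>The vector \<open>v\<close> splits into \<open>w\<close> in the range of
  \<open>A\<^sup>T\<close> and \<open>q\<close> in the kernel of \<open>A\<close>. By Pythagoras
  \<open>q\<close> is the closest kernel vector and the only one, as the description in
  \<open>proj\<close> demands.\<close>

lemma proj_mat_kernel:
  assumes A: "A \<in> carrier_mat m n" and v: "v \<in> carrier_vec n"
  shows "proj (mat_kernel A) v = v - pinv A *\<^sub>v (A *\<^sub>v v)"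
proof -
  define X where "X = pinv A"
  have X: "X \<in> carrier_mat n m" using A by (simp add: X_def pinv_carrier)
  note p = pinv_props[OF A, folded X_def]
  define w where "w = X *\<^sub>v (A *\<^sub>v v)"
  have w: "w \<in> carrier_vec n" using X by (simp add: w_def carrier_dim_vec)
  define q where "q = v - w"
  have q: "q \<in> carrier_vec n" using v w by (simp add: q_def)
  have Aw: "A *\<^sub>v w = A *\<^sub>v v"
  proof -
    have "A *\<^sub>v w = A * X * A *\<^sub>v v" 
      using A X v by (simp add: w_def mult_mat_assoc_dim mult_mat_vec_assoc_dim)
    then show ?thesis by (simp only: p)
  qed
  have qker: "q \<in> mat_kernel A"
    using A v w q by (intro mat_kernelI) (auto simp: q_def mult_minus_distrib_mat_vec[of _ m n] Aw)
  \<comment> \<open>Membership in the range of \<open>A\<^sup>T\<close> is what makes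
    \<open>w\<close> orthogonal to the kernel of \<open>A\<close>.\<close>
  have wX: "w = A\<^sup>T *\<^sub>v (X\<^sup>T *\<^sub>v v)"
  proof -
    have "w = X * A *\<^sub>v v" using A X v by (simp add: w_def)
    also have "\<dots> = A\<^sup>T *\<^sub>v (X\<^sup>T *\<^sub>v v)" unfolding p(4)[symmetric] using A X v by simp
    finally show ?thesis .
  qed
  have split: "(v - r) \<bullet> (v - r) = w \<bullet> w + (q - r) \<bullet> (q - r)" if "r \<in> mat_kernel A" for r
  proof -
    have r: "r \<in> carrier_vec n" "A *\<^sub>v r = 0\<^sub>v m" using mat_kernelD[OF A that] .
    have "w \<bullet> (q - r) = (X\<^sup>T *\<^sub>v v) \<bullet> (A *\<^sub>v (q - r))"
      unfolding wX using A X v q r by (intro mult_transpose_scalar[of _ m n]) auto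
    also have "\<dots> = 0"
      using A X v q r mat_kernelD[OF A qker] by (simp add: mult_minus_distrib_mat_vec[of _ m n])
    finally have 0: "w \<bullet> (q - r) = 0" .
    have "v - r = w + (q - r)" using v w r by (intro eq_vecI) (auto simp: q_def)
    then show ?thesis using scalar_self_add[of w n "q - r"] w q r 0 by simp
  qed
  have qq: "(q - q) \<bullet> (q - q) = 0" using q by simp
  show ?thesis unfolding proj_def X_def[symmetric] w_def[symmetric] q_def[symmetric]
  proof (rule the_equality)
    show "q \<in> mat_kernel A \<and> (\<forall>r\<in>mat_kernel A. l2_norm (v - q) \<le> l2_norm (v - r))"
      using qker split[OF qker] qq by (auto simp: l2_norm_le_iff split scalar_self_nonneg)
  next
    fix r assume r: "r \<in> mat_kernel A \<and> (\<forall>r'\<in>mat_kernel A. l2_norm (v - r) \<le> l2_norm (v - r'))"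
    then have "(v - r) \<bullet> (v - r) \<le> (v - q) \<bullet> (v - q)" using qker by (simp add: l2_norm_le_iff)
    then have "(q - r) \<bullet> (q - r) \<le> 0" using r split[OF qker] split[of r] qq by simp
    then have "(q - r) \<bullet> (q - r) = 0" using scalar_self_nonneg[of "q - r"] by simp
    then have eq: "q - r = 0\<^sub>v n"
      using scalar_self_eq_0_iff[of "q - r"] q r mat_kernelD(1)[OF A, of r] by simp
    show "r = q"
    proof (rule eq_vecI)
      fix i assume "i < dim_vec q"
      then show "r $ i = q $ i"
        using arg_cong[OF eq, of "\<lambda>x. x $ i"] q r mat_kernelD(1)[OF A, of r] by simp
    qed (use q r mat_kernelD(1)[OF A, of r] in simp)
  qed
qed

text \<open>By \<open>normal\<close> the residual is orthogonal to the range of \<open>A\<close>, so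
  passing from \<open>x\<close> to \<open>x'\<close> adds a vector at a right angle to it.\<close>

lemma least_squares_is_arg_min:
  assumes A: "A \<in> carrier_mat m n" and b: "b \<in> carrier_vec m" and x: "x \<in> carrier_vec n"
    and normal: "A\<^sup>T *\<^sub>v (A *\<^sub>v x - b) = 0\<^sub>v n"
  shows "is_arg_min (\<lambda>x. l2_norm (A *\<^sub>v x - b)) (\<lambda>x. x \<in> carrier_vec n) x"
proof -
  have "l2_norm (A *\<^sub>v x - b) \<le> l2_norm (A *\<^sub>v x' - b)" if x': "x' \<in> carrier_vec n" for x'
  proof -
    define r where "r = A *\<^sub>v x - b"
    have r: "r \<in> carrier_vec m" unfolding r_def using b by (rule minus_carrier_vec[OF mult_mat_vec_carrier[OF A x]])
    have "A *\<^sub>v x' - b = r + A *\<^sub>v (x' - x)"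
      unfolding r_def mult_minus_distrib_mat_vec[OF A x' x]
      using A b by (intro eq_vecI) simp_all
    moreover have "r \<bullet> (A *\<^sub>v (x' - x)) = 0"
      using mult_transpose_scalar[OF A _ r, of "x' - x"] normal x x' by (simp add: r_def)
    ultimately show ?thesis
      using scalar_self_add[OF r, of "A *\<^sub>v (x' - x)"] A x x' scalar_self_nonneg[of "A *\<^sub>v (x' - x)"]
      by (simp add: l2_norm_le_iff r_def)
  qed
  then show ?thesis using x by (force simp: is_arg_min_def)
qed

lemma pinv_residual:
  assumes A: "A \<in> carrier_mat m n" and b: "b \<in> carrier_vec m"
  shows "A\<^sup>T *\<^sub>v (A *\<^sub>v (pinv A *\<^sub>v b) - b) = 0\<^sub>v n"
proof -
  note X = pinv_carrier[OF A]
  have "A\<^sup>T *\<^sub>v (A *\<^sub>v (pinv A *\<^sub>v b)) = A\<^sup>T * A * pinv A *\<^sub>v b"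
    using A X b by (simp add: mult_mat_assoc_dim mult_mat_vec_assoc_dim)
  also have "\<dots> = A\<^sup>T *\<^sub>v b" by (simp only: pinv_props[OF A])
  finally show ?thesis using A X b by (simp add: mult_minus_distrib_mat_vec[of _ n m])
qed

section \<open>Norm bounds and convergence of the rotation\<close>

lemma l2_norm_smult: "l2_norm (a \<cdot>\<^sub>v v) = \<bar>a\<bar> * l2_norm v"
  by (simp add: l2_norm_def real_sqrt_mult mult.assoc[symmetric] power2_eq_square[symmetric])

lemma abs_index_le_l2_norm:
  assumes "i < dim_vec v"
  shows "\<bar>v $ i\<bar> \<le> l2_norm v"
proof -
  have "(v $ i)\<^sup>2 \<le> v \<bullet> v"
    unfolding scalar_prod_def power2_eq_square
    using assms by (intro member_le_sum) auto
  then show ?thesis by (metis l2_norm_def real_sqrt_abs real_sqrt_le_iff)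
qed

text \<open>The supremum in \<open>spectral_norm\<close> is known to bound its elements only once
  the set is bounded above. Coordinates of vectors in the unit ball are at most 1 in absolute value,
  so absolute row sums bound the image.\<close>

lemma bdd_above_spectral_norm:
  "bdd_above ((\<lambda>v. l2_norm (A *\<^sub>v v)) ` {v \<in> carrier_vec (dim_col A). l2_norm v \<le> 1})"
proof (rule bdd_aboveI2)
  fix v assume v: "v \<in> {v \<in> carrier_vec (dim_col A). l2_norm v \<le> 1}"
  have "\<bar>(A *\<^sub>v v) $ i\<bar> \<le> (\<Sum>j<dim_col A. \<bar>A $$ (i, j)\<bar>)" if i: "i < dim_row A" for i
  proof -
    have "\<bar>(A *\<^sub>v v) $ i\<bar> \<le> (\<Sum>j<dim_col A. \<bar>A $$ (i, j) * v $ j\<bar>)"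
      using i v by (auto simp: scalar_prod_def atLeast0LessThan intro!: order_trans[OF sum_abs])
    also have "\<dots> \<le> (\<Sum>j<dim_col A. \<bar>A $$ (i, j)\<bar>)"
    proof (rule sum_mono)
      fix j assume "j \<in> {..<dim_col A}"
      then have "\<bar>v $ j\<bar> \<le> 1" using v abs_index_le_l2_norm[of j v] by auto
      then show "\<bar>A $$ (i, j) * v $ j\<bar> \<le> \<bar>A $$ (i, j)\<bar>"
        by (simp add: abs_mult mult_left_le)
    qed
    finally show ?thesis .
  qed
  then have "((A *\<^sub>v v) $ i)\<^sup>2 \<le> (\<Sum>j<dim_col A. \<bar>A $$ (i, j)\<bar>)\<^sup>2" if "i < dim_row A" for i
    using that by (metis abs_ge_zero power2_abs power_mono)
  then have "(A *\<^sub>v v) \<bullet> (A *\<^sub>v v) \<le> (\<Sum>i<dim_row A. (\<Sum>j<dim_col A. \<bar>A $$ (i, j)\<bar>)\<^sup>2)"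
    unfolding scalar_prod_def power2_eq_square[symmetric] by (auto simp: atLeast0LessThan intro!: sum_mono)
  then show "l2_norm (A *\<^sub>v v) \<le> sqrt (\<Sum>i<dim_row A. (\<Sum>j<dim_col A. \<bar>A $$ (i, j)\<bar>)\<^sup>2)"
    by (simp add: l2_norm_def)
qed

lemma l2_norm_mult_mat_vec_le:
  assumes v: "v \<in> carrier_vec (dim_col A)"
  shows "l2_norm (A *\<^sub>v v) \<le> spectral_norm A * l2_norm v"
proof (cases "l2_norm v = 0")
  case True
  then have "v = 0\<^sub>v (dim_col A)"
    using v scalar_self_eq_0_iff[of v] by (simp add: l2_norm_def)
  then have "A *\<^sub>v v = 0\<^sub>v (dim_row A)" by auto
  then show ?thesis using True by (simp add: l2_norm_def)
next
  case False
  then have pos: "l2_norm v > 0" using l2_norm_nonneg[of v] by simp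
  define u where "u = (1 / l2_norm v) \<cdot>\<^sub>v v"
  have "u \<in> carrier_vec (dim_col A)" "l2_norm u \<le> 1" using v pos by (simp_all add: u_def l2_norm_smult)
  then have "l2_norm (A *\<^sub>v u) \<le> spectral_norm A"
    unfolding spectral_norm_def by (intro cSUP_upper bdd_above_spectral_norm) simp
  moreover have "A *\<^sub>v u = (1 / l2_norm v) \<cdot>\<^sub>v (A *\<^sub>v v)"
    unfolding u_def using v by (intro mult_mat_vec[of A "dim_row A" "dim_col A"]) auto
  ultimately show ?thesis using pos by (simp add: l2_norm_smult pos_divide_le_eq)
qed

text \<open>Applied to a pseudoinverse, this recovers convergence of a sequence from convergence of
  its image.\<close>

lemma tendsto_mult_mat_vec_0:
  assumes "\<And>k. u k \<in> carrier_vec (dim_col A)" "(\<lambda>k. l2_norm (u k)) \<longlonglongrightarrow> 0"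
  shows "(\<lambda>k. l2_norm (A *\<^sub>v u k)) \<longlonglongrightarrow> 0"
proof (rule tendsto_sandwich[OF _ _ tendsto_const])
  show "(\<lambda>k. spectral_norm A * l2_norm (u k)) \<longlonglongrightarrow> 0"
    using tendsto_mult_left[OF assms(2), of "spectral_norm A"] by simp
qed (auto simp: l2_norm_nonneg intro!: always_eventually l2_norm_mult_mat_vec_le assms)

section \<open>Restriction to the basis columns and extension by zero\<close>

lemma Collect_less_mem_eq:
  fixes n :: nat
  shows "B \<subseteq> {..<n} \<Longrightarrow> {i. i < n \<and> i \<in> B} = B"
  by auto

text \<open>Extension by zero is the adjoint of restriction to \<open>B\<close>. Products with
  \<open>sub_cols\<close>, norms of extended vectors and the slope of the gap are all reduced to
  this identity.\<close>

lemma scalar_prod_extend_vec: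
  assumes B: "B \<subseteq> {..<n}" and c: "c \<in> carrier_vec n" and w: "w \<in> carrier_vec (card B)"
  shows "c \<bullet> extend_vec n B w = sub_vec c B \<bullet> w"
proof -
  have fin: "finite B" using B finite_subset by blast
  \<comment> \<open>The rank of an index within \<open>B\<close> and \<open>pick B\<close> are
    mutually inverse renumberings.\<close>
  have bij: "bij_betw (\<lambda>i. card {j \<in> B. j < i}) B {..<card B}"
  proof (rule bij_betw_byWitness[where f' = "pick B"])
    show "\<forall>i\<in>B. pick B (card {j \<in> B. j < i}) = i" by (simp add: pick_card_in_set)
    show "\<forall>k\<in>{..<card B}. card {j \<in> B. j < pick B k} = k" by (simp add: card_pick)
    show "(\<lambda>i. card {j \<in> B. j < i}) ` B \<subseteq> {..<card B}"
      using fin by (auto intro!: psubset_card_mono)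
    show "pick B ` {..<card B} \<subseteq> B" by (auto simp: pick_in_set_le)
  qed
  have "c \<bullet> extend_vec n B w = (\<Sum>i<n. if i \<in> B then c $ i * w $ card {j \<in> B. j < i} else 0)"
    by (auto simp: scalar_prod_def extend_vec_def atLeast0LessThan intro!: sum.cong)
  also have "\<dots> = (\<Sum>i\<in>B. c $ i * w $ card {j \<in> B. j < i})"
    using B by (subst sum.inter_restrict[symmetric]) (auto simp: Int_absorb1)
  also have "\<dots> = (\<Sum>i\<in>B. c $ pick B (card {j \<in> B. j < i}) * w $ card {j \<in> B. j < i})"
    by (intro sum.cong) (auto simp: pick_card_in_set)
  also have "\<dots> = (\<Sum>k<card B. c $ pick B k * w $ k)"
    using sum.reindex_bij_betw[OF bij, of "\<lambda>k. c $ pick B k * w $ k"] by simp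
  also have "\<dots> = sub_vec c B \<bullet> w"
    using c w B by (auto simp: scalar_prod_def sub_vec_def Collect_less_mem_eq atLeast0LessThan intro!: sum.cong)
  finally show ?thesis .
qed

lemma sub_cols_carrier:
  assumes "A \<in> carrier_mat m n" "B \<subseteq> {..<n}"
  shows "sub_cols A B \<in> carrier_mat m (card B)"
  using assms by (intro carrier_matI) (simp_all add: dim_submatrix Collect_less_mem_eq)

lemma sub_cols_mult_vec:
  assumes A: "A \<in> carrier_mat m n" and B: "B \<subseteq> {..<n}" and w: "w \<in> carrier_vec (card B)"
  shows "sub_cols A B *\<^sub>v w = A *\<^sub>v extend_vec n B w"
proof (rule eq_vecI)
  note K = sub_cols_carrier[OF A B]
  fix i assume "i < dim_vec (A *\<^sub>v extend_vec n B w)"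
  then have i: "i < m" using A by simp
  have "row (sub_cols A B) i = sub_vec (row A i) B"
  proof (rule eq_vecI)
    fix k assume "k < dim_vec (sub_vec (row A i) B)"
    then have k: "k < card B" using A B by (simp add: sub_vec_def Collect_less_mem_eq)
    then have "pick B k < n" using B pick_le[of k n B] by (simp add: Collect_less_mem_eq)
    then show "row (sub_cols A B) i $ k = sub_vec (row A i) B $ k"
      using A B K i k by (simp add: sub_vec_def Collect_less_mem_eq submatrix_index pick_UNIV)
  qed (use A B K in \<open>simp add: sub_vec_def Collect_less_mem_eq\<close>)
  moreover have "row A i \<bullet> extend_vec n B w = sub_vec (row A i) B \<bullet> w"
    using A B w i by (intro scalar_prod_extend_vec) auto
  ultimately show "(sub_cols A B *\<^sub>v w) $ i = (A *\<^sub>v extend_vec n B w) $ i"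
    using A K i by simp
qed (use A sub_cols_carrier[OF A B] in simp)

lemma l2_norm_extend_vec:
  assumes B: "B \<subseteq> {..<n}" and w: "w \<in> carrier_vec (card B)"
  shows "l2_norm (extend_vec n B w) = l2_norm w"
proof -
  have "extend_vec n B w \<bullet> extend_vec n B w = sub_vec (extend_vec n B w) B \<bullet> w"
    using B w by (intro scalar_prod_extend_vec) (simp_all add: extend_vec_def)
  also have "\<dots> = w \<bullet> w" using B w by (simp add: sub_vec_extend_vec Collect_less_mem_eq)
  finally show ?thesis by (simp add: l2_norm_def)
qed

text \<open>Extension by zero is isometric, so the bound for \<open>A\<close> passes to its column
  submatrices.\<close>

lemma l2_norm_sub_cols_mult_le:
  assumes A: "A \<in> carrier_mat m n" and B: "B \<subseteq> {..<n}" and w: "w \<in> carrier_vec (card B)"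
  shows "l2_norm (sub_cols A B *\<^sub>v w) \<le> spectral_norm A * l2_norm w"
proof -
  have "l2_norm (A *\<^sub>v extend_vec n B w) \<le> spectral_norm A * l2_norm (extend_vec n B w)"
    using A by (intro l2_norm_mult_mat_vec_le) (simp add: extend_vec_def)
  then show ?thesis by (simp add: sub_cols_mult_vec[OF assms] l2_norm_extend_vec[OF B w])
qed

section \<open>Energy decay and convergence of the rotation\<close>

text \<open>Completing the square explains the identity: the terms in \<open>y'\<close> equal the
  squared norm of \<open>y' + L *\<^sub>v x'\<close> minus that of \<open>L *\<^sub>v x'\<close>,
  and \<open>y' + L *\<^sub>v x'\<close> is \<open>y - L *\<^sub>v d\<close>. Adjointness supplies
  \<open>dx\<close> and \<open>dd\<close>.\<close>

lemma rotation_energy_step: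
  fixes L :: "real mat"
  assumes L: "L \<in> carrier_mat m p" and x: "x \<in> carrier_vec p" and y: "y \<in> carrier_vec m"
  defines "d \<equiv> L\<^sup>T *\<^sub>v y"
  defines "x' \<equiv> x + d" and "y' \<equiv> y - (L *\<^sub>v x + 2 \<cdot>\<^sub>v (L *\<^sub>v d))"
  shows "x' \<bullet> x' + y' \<bullet> y' + 2 * (y' \<bullet> (L *\<^sub>v x')) =
    x \<bullet> x + y \<bullet> y + 2 * (y \<bullet> (L *\<^sub>v x))
    - (d \<bullet> d - (L *\<^sub>v d) \<bullet> (L *\<^sub>v d)) - (L *\<^sub>v x') \<bullet> (L *\<^sub>v x')"
proof -
  define u where "u = L *\<^sub>v x"
  define r where "r = L *\<^sub>v d"
  have d: "d \<in> carrier_vec p" using L by (intro carrier_vecI) (simp add: d_def)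
  have u: "u \<in> carrier_vec m" and r: "r \<in> carrier_vec m"
    using L by (auto intro!: carrier_vecI simp: u_def r_def)
  have Lx': "L *\<^sub>v x' = u + r" using L x d by (simp add: x'_def u_def r_def mult_add_distrib_mat_vec)
  have dx: "x \<bullet> d = y \<bullet> u"
    using mult_transpose_scalar[OF L x y] comm_scalar_prod[OF x d] by (simp add: d_def u_def)
  have dd: "d \<bullet> d = y \<bullet> r"
    using mult_transpose_scalar[OF L d y] by (simp add: d_def[symmetric] r_def)
  have swap: "r \<bullet> u = u \<bullet> r" "u \<bullet> y = y \<bullet> u" "r \<bullet> y = y \<bullet> r"
    using comm_scalar_prod u r y by blast+
  have 2: "2 \<cdot>\<^sub>v r \<in> carrier_vec m" using r by simp
  show ?thesis
    unfolding Lx' unfolding x'_def y'_def u_def[symmetric] r_def[symmetric] scalar_self_add[OF x d]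
    using u r y 2 add_carrier_vec[OF u r] add_carrier_vec[OF u 2]
    by (simp add: minus_scalar_prod_distrib[of _ m] scalar_prod_minus_distrib[of _ m]
        add_scalar_prod_distrib[of _ m] scalar_prod_add_distrib[of _ m] swap dx dd algebra_simps)
qed

text \<open>Vectors in the kernels of \<open>L\<close> and \<open>L\<^sup>T\<close> are fixed by the
  recursion; starting in the ranges of \<open>L\<^sup>T\<close> and \<open>L\<close> excludes such
  stationary parts.\<close>

lemma rotation_tendsto_0:
  fixes L :: "real mat" and x y :: "nat \<Rightarrow> real vec"
  assumes L: "L \<in> carrier_mat m p"
    and q: "0 \<le> q" "q < 1" "\<And>v. v \<in> carrier_vec p \<Longrightarrow> l2_norm (L *\<^sub>v v) \<le> q * l2_norm v"
    and u: "u \<in> carrier_vec m" "x 0 = L\<^sup>T *\<^sub>v u" and w: "w \<in> carrier_vec p" "y 0 = L *\<^sub>v w"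
    and x_Suc: "\<And>k. x (Suc k) = x k + L\<^sup>T *\<^sub>v y k"
    and y_Suc: "\<And>k. y (Suc k) = y k - (L *\<^sub>v x k + 2 \<cdot>\<^sub>v (L *\<^sub>v (L\<^sup>T *\<^sub>v y k)))"
  shows "(\<lambda>k. l2_norm (x k)) \<longlonglongrightarrow> 0" "(\<lambda>k. l2_norm (y k)) \<longlonglongrightarrow> 0"
proof -
  define M where "M = pinv L"
  have M: "M \<in> carrier_mat p m" using L by (simp add: M_def pinv_carrier)
  note pm = pinv_props[OF L, folded M_def]
  have Lv: "L *\<^sub>v v \<in> carrier_vec m" and Ltv: "L\<^sup>T *\<^sub>v v \<in> carrier_vec p" for v
    using L by (auto intro!: carrier_vecI)
  \<comment> \<open>\<open>M * L\<close> is the orthogonal projector onto the range of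
    \<open>L\<^sup>T\<close>; likewise \<open>M\<^sup>T * L\<^sup>T\<close> below for the range of
    \<open>L\<close>.\<close>
  have MLLt: "M *\<^sub>v (L *\<^sub>v (L\<^sup>T *\<^sub>v v)) = L\<^sup>T *\<^sub>v v" if "v \<in> carrier_vec m" for v
  proof -
    have "M *\<^sub>v (L *\<^sub>v (L\<^sup>T *\<^sub>v v)) = M * L *\<^sub>v (L\<^sup>T *\<^sub>v v)"
      using M L by (simp add: mult_mat_vec_assoc_dim)
    also have "\<dots> = (M * L) * L\<^sup>T *\<^sub>v v"
      using M L that by (intro mult_mat_vec_assoc_dim[symmetric]) auto
    also have "(M * L) * L\<^sup>T = L\<^sup>T"
      using is_pinv_transpose[OF is_pinv_pinv[of L]] unfolding is_pinv_def M_def[symmetric] pm by simp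
    finally show ?thesis .
  qed
  have MtLtL: "M\<^sup>T *\<^sub>v (L\<^sup>T *\<^sub>v (L *\<^sub>v v)) = L *\<^sub>v v" if "v \<in> carrier_vec p" for v
  proof -
    have "M\<^sup>T *\<^sub>v (L\<^sup>T *\<^sub>v (L *\<^sub>v v)) = M\<^sup>T * L\<^sup>T *\<^sub>v (L *\<^sub>v v)"
      using M L by (simp add: mult_mat_vec_assoc_dim)
    also have "\<dots> = M\<^sup>T * L\<^sup>T * L *\<^sub>v v"
      using M L that by (intro mult_mat_vec_assoc_dim[symmetric]) auto
    finally show ?thesis by (simp only: pm)
  qed
  have ranges: "(\<exists>v \<in> carrier_vec m. x k = L\<^sup>T *\<^sub>v v) \<and> (\<exists>v \<in> carrier_vec p. y k = L *\<^sub>v v)" for k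
  proof (induction k)
    case 0
    then show ?case using u w by blast
  next
    case (Suc k)
    then obtain u' w' where *: "u' \<in> carrier_vec m" "x k = L\<^sup>T *\<^sub>v u'"
      "w' \<in> carrier_vec p" "y k = L *\<^sub>v w'" by blast
    have "x (Suc k) = L\<^sup>T *\<^sub>v (u' + y k)"
      unfolding x_Suc *(2) using L *(1) Lv[of w']
      by (subst mult_add_distrib_mat_vec[of _ p m]) (simp_all add: *(4))
    moreover have "y (Suc k) = L *\<^sub>v (w' - (x k + 2 \<cdot>\<^sub>v (L\<^sup>T *\<^sub>v y k)))"
      unfolding y_Suc using L *(3) Ltv[of u'] Ltv[of "y k"]
      by (simp add: mult_minus_distrib_mat_vec[OF L] mult_add_distrib_mat_vec[OF L] mult_mat_vec[OF L] *(2,4))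
    moreover have "u' + y k \<in> carrier_vec m" "w' - (x k + 2 \<cdot>\<^sub>v (L\<^sup>T *\<^sub>v y k)) \<in> carrier_vec p"
      using *(1,3) Lv[of w'] Ltv by (simp_all add: *(2,4))
    ultimately show ?case by blast
  qed
  have x: "x k \<in> carrier_vec p" and y: "y k \<in> carrier_vec m" for k
    using ranges[of k] Lv Ltv by auto
  have xM: "M *\<^sub>v (L *\<^sub>v x k) = x k" and yM: "M\<^sup>T *\<^sub>v (L\<^sup>T *\<^sub>v y k) = y k" for k
    using ranges[of k] MLLt MtLtL by auto
  have sq_le: "(L *\<^sub>v v) \<bullet> (L *\<^sub>v v) \<le> q\<^sup>2 * (v \<bullet> v)" if "v \<in> carrier_vec p" for v
    using power_mono[OF q(3)[OF that] l2_norm_nonneg, of 2] by (simp add: power_mult_distrib l2_norm_sq)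
  have q2: "q\<^sup>2 < 1" using q(1,2) by (simp add: power_less_one_iff abs_square_less_1)
  \<comment> \<open>The squared norm of \<open>(x, y)\<close> in the metric that makes the iteration nonexpansive.\<close>
  define Q where "Q k = x k \<bullet> x k + y k \<bullet> y k + 2 * (y k \<bullet> (L *\<^sub>v x k))" for k
  define d where "d k = L\<^sup>T *\<^sub>v y k" for k
  define \<epsilon> where "\<epsilon> k = Q k - Q (Suc k)" for k
  have d: "d k \<in> carrier_vec p" for k by (simp add: d_def Ltv)
  have \<epsilon>_eq: "\<epsilon> k = (d k \<bullet> d k - (L *\<^sub>v d k) \<bullet> (L *\<^sub>v d k)) + (L *\<^sub>v x (Suc k)) \<bullet> (L *\<^sub>v x (Suc k))" for k
    using rotation_energy_step[OF L x[of k] y[of k]] unfolding \<epsilon>_def Q_def x_Suc y_Suc d_def by simp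
  \<comment> \<open>The strict bound \<open>q < 1\<close> enters here: the energy loss controls a
    positive multiple of the squared norm of \<open>d k\<close>.\<close>
  have d_le: "(1 - q\<^sup>2) * (d k \<bullet> d k) \<le> d k \<bullet> d k - (L *\<^sub>v d k) \<bullet> (L *\<^sub>v d k)" for k
    using sq_le[OF d[of k]] by (simp add: algebra_simps)
  have d_nonneg: "0 \<le> (1 - q\<^sup>2) * (d k \<bullet> d k)" for k using q2 scalar_self_nonneg[of "d k"] by simp
  \<comment> \<open>\<open>Q k\<close> is the squared norm of \<open>y k + L *\<^sub>v x k\<close>
    plus the difference of the squared norms of \<open>x k\<close> and
    \<open>L *\<^sub>v x k\<close>.\<close>
  have Q_nonneg: "0 \<le> Q k" for k
  proof -
    have "(L *\<^sub>v x k) \<bullet> (L *\<^sub>v x k) \<le> x k \<bullet> x k"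
      using sq_le[OF x[of k]] q2 scalar_self_nonneg[of "x k"]
      by (smt (verit) mult_left_le_one_le zero_le_power2)
    then show ?thesis
      using scalar_self_add[OF y[of k] Lv[of "x k"]] scalar_self_nonneg[of "y k + L *\<^sub>v x k"]
      by (simp add: Q_def)
  qed
  have "0 \<le> \<epsilon> k" for k
    using \<epsilon>_eq[of k] d_le[of k] d_nonneg[of k] scalar_self_nonneg[of "L *\<^sub>v x (Suc k)"] by linarith
  \<comment> \<open>The losses telescope and the remaining energy is nonnegative, so they form a
    convergent series.\<close>
  moreover have "(\<Sum>k<n. \<epsilon> k) \<le> Q 0" for n
    using sum_lessThan_telescope'[of Q n] Q_nonneg[of n] by (simp add: \<epsilon>_def)
  ultimately have \<epsilon>_0: "\<epsilon> \<longlonglongrightarrow> 0"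
    by (intro summable_LIMSEQ_zero summableI_nonneg_bounded)
  \<comment> \<open>The loss in step \<open>k\<close> contains the new point
    \<open>x (Suc k)\<close>; the shift is undone after \<open>M\<close> has been applied.\<close>
  have "(\<lambda>k. (L *\<^sub>v x (Suc k)) \<bullet> (L *\<^sub>v x (Suc k))) \<longlonglongrightarrow> 0"
  proof (rule tendsto_sandwich[OF _ _ tendsto_const \<epsilon>_0])
    show "\<forall>\<^sub>F k in sequentially. (L *\<^sub>v x (Suc k)) \<bullet> (L *\<^sub>v x (Suc k)) \<le> \<epsilon> k"
      by (intro always_eventually allI) (use \<epsilon>_eq d_le d_nonneg in smt)
  qed (simp add: scalar_self_nonneg)
  then have "(\<lambda>k. l2_norm (L *\<^sub>v x (Suc k))) \<longlonglongrightarrow> 0"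
    unfolding l2_norm_def using tendsto_real_sqrt by fastforce
  then have "(\<lambda>k. l2_norm (M *\<^sub>v (L *\<^sub>v x (Suc k)))) \<longlonglongrightarrow> 0"
    by (rule tendsto_mult_mat_vec_0[rotated]) (use L M in \<open>auto intro!: carrier_vecI\<close>)
  then show "(\<lambda>k. l2_norm (x k)) \<longlonglongrightarrow> 0"
    unfolding xM by (subst (asm) filterlim_sequentially_Suc)
  have "(\<lambda>k. d k \<bullet> d k) \<longlonglongrightarrow> 0"
  proof (rule tendsto_sandwich[OF _ _ tendsto_const])
    show "(\<lambda>k. \<epsilon> k / (1 - q\<^sup>2)) \<longlonglongrightarrow> 0" using tendsto_divide[OF \<epsilon>_0 tendsto_const, of "1 - q\<^sup>2"] q2 by simp
    have "(1 - q\<^sup>2) * (d k \<bullet> d k) \<le> \<epsilon> k" for k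
      using \<epsilon>_eq[of k] d_le[of k] scalar_self_nonneg[of "L *\<^sub>v x (Suc k)"] by linarith
    then show "\<forall>\<^sub>F k in sequentially. d k \<bullet> d k \<le> \<epsilon> k / (1 - q\<^sup>2)"
      using q2 by (intro always_eventually allI) (simp add: pos_le_divide_eq mult.commute)
  qed (simp add: scalar_self_nonneg)
  then have "(\<lambda>k. l2_norm (d k)) \<longlonglongrightarrow> 0"
    unfolding l2_norm_def using tendsto_real_sqrt by fastforce
  then have "(\<lambda>k. l2_norm (M\<^sup>T *\<^sub>v d k)) \<longlonglongrightarrow> 0"
    by (rule tendsto_mult_mat_vec_0[rotated]) (use L M in \<open>auto intro!: carrier_vecI simp: d_def\<close>)
  then show "(\<lambda>k. l2_norm (y k)) \<longlonglongrightarrow> 0" unfolding d_def yM .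
qed

section \<open>The spiral center and the ray\<close>

lemma smult_mat_mult_vec:
  fixes A :: "real mat"
  assumes "dim_vec v = dim_col A"
  shows "(a \<cdot>\<^sub>m A) *\<^sub>v v = a \<cdot>\<^sub>v (A *\<^sub>v v)"
  using assms by (intro eq_vecI) auto

lemma mult_mat_smult_vec:
  fixes A :: "real mat"
  assumes "dim_vec v = dim_col A"
  shows "A *\<^sub>v (a \<cdot>\<^sub>v v) = a \<cdot>\<^sub>v (A *\<^sub>v v)"
  using assms by (intro mult_mat_vec[of A "dim_row A" "dim_col A"]) (auto intro: carrier_vecI)

text \<open>Absorbing the step size into \<open>L\<close> brings the block matrix into the form of
  the recursion in \<open>rotation_tendsto_0\<close>.\<close>

lemma P_mat_mult_vec:
  fixes A :: "real mat" and \<eta> :: real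
  assumes A: "A \<in> carrier_mat m n" and B: "B \<subseteq> {..<n}"
    and x: "x \<in> carrier_vec (card B)" and y: "y \<in> carrier_vec m"
  defines "L \<equiv> \<eta> \<cdot>\<^sub>m sub_cols A B"
  shows "P_mat A \<eta> B *\<^sub>v (x @\<^sub>v y) =
    (x + L\<^sup>T *\<^sub>v y) @\<^sub>v (y - (L *\<^sub>v x + 2 \<cdot>\<^sub>v (L *\<^sub>v (L\<^sup>T *\<^sub>v y))))"
proof -
  define K where "K = sub_cols A B"
  have K: "K \<in> carrier_mat m (card B)" unfolding K_def using A B by (rule sub_cols_carrier)
  have L: "L = \<eta> \<cdot>\<^sub>m K" by (simp add: L_def K_def)
  have Lt: "L\<^sup>T = \<eta> \<cdot>\<^sub>m K\<^sup>T" unfolding L using K by (intro eq_matI) auto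
  define g where "g = K *\<^sub>v (K\<^sup>T *\<^sub>v y)"
  have g: "g \<in> carrier_vec m" using K by (intro carrier_vecI) (simp add: g_def)
  have LLt: "L *\<^sub>v (L\<^sup>T *\<^sub>v y) = \<eta>\<^sup>2 \<cdot>\<^sub>v g"
    using K y unfolding Lt unfolding L
    by (simp add: smult_mat_mult_vec g_def mult_mat_smult_vec
        smult_smult_assoc power2_eq_square)
  have "(1\<^sub>m m - (2 * \<eta>\<^sup>2) \<cdot>\<^sub>m (K * K\<^sup>T)) *\<^sub>v y = y - (2 * \<eta>\<^sup>2) \<cdot>\<^sub>v g"
    using K y by (subst minus_mult_distrib_mat_vec[of _ m m])
      (auto simp: smult_mat_mult_vec mult_mat_vec_assoc_dim g_def)
  moreover have "- L *\<^sub>v x + (y - (2 * \<eta>\<^sup>2) \<cdot>\<^sub>v g) = y - (L *\<^sub>v x + 2 \<cdot>\<^sub>v (L *\<^sub>v (L\<^sup>T *\<^sub>v y)))"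
    unfolding LLt using K x y g by (intro eq_vecI) (auto simp: L)
  ultimately show ?thesis
    unfolding P_mat_def Let_def K_def[symmetric] L_def[symmetric] Lt[symmetric]
    using K x y
    by (subst four_block_mat_mult_vec[of _ "card B" "card B" _ m _ m]) (auto simp: L L_def K_def)
qed

text \<open>Exhibits an explicit preimage under \<open>A\<^sup>T\<close>, needed to start the
  rotation in the right range.\<close>

lemma pinv_range:
  assumes A: "A \<in> carrier_mat m n" and v: "v \<in> carrier_vec m"
  shows "pinv A *\<^sub>v v = A\<^sup>T *\<^sub>v ((pinv A)\<^sup>T *\<^sub>v (pinv A *\<^sub>v v))"
proof -
  note X = pinv_carrier[OF A]
  have "A\<^sup>T *\<^sub>v ((pinv A)\<^sup>T *\<^sub>v (pinv A *\<^sub>v v)) = A\<^sup>T * (pinv A)\<^sup>T * pinv A *\<^sub>v v"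
    using A X v by (simp add: mult_mat_assoc_dim mult_mat_vec_assoc_dim)
  then show ?thesis by (simp only: pinv_props[OF A])
qed

text \<open>The kernel part does not change \<open>A *\<^sub>v x\<close>, so the normal equations
  for \<open>pinv A *\<^sub>v b\<close> persist. The general \<open>A\<close> allows use for the
  primal center and, with the transpose, for the dual one.\<close>

lemma kernel_shifted_pinv_is_arg_min:
  assumes A: "A \<in> carrier_mat m n" and b: "b \<in> carrier_vec m" and x0: "x0 \<in> carrier_vec n"
  shows "is_arg_min (\<lambda>x. l2_norm (A *\<^sub>v x - b)) (\<lambda>x. x \<in> carrier_vec n)
    (pinv (A\<^sup>T * A) *\<^sub>v (A\<^sup>T *\<^sub>v b) + proj (mat_kernel A) x0)"
proof -
  note X = pinv_carrier[OF A]
  define p where "p = x0 - pinv A *\<^sub>v (A *\<^sub>v x0)"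
  have p: "p \<in> carrier_vec n" using X by (intro carrier_vecI) (simp add: p_def)
  have "A *\<^sub>v (pinv A *\<^sub>v (A *\<^sub>v x0)) = A * pinv A * A *\<^sub>v x0"
    using A X x0 by (simp add: mult_mat_assoc_dim mult_mat_vec_assoc_dim)
  then have "A *\<^sub>v (pinv A *\<^sub>v (A *\<^sub>v x0)) = A *\<^sub>v x0" by (simp only: pinv_props[OF A])
  then have "A *\<^sub>v p = 0\<^sub>v m"
    using A X x0 by (simp add: p_def mult_minus_distrib_mat_vec[of _ m n])
  then have "A *\<^sub>v (pinv A *\<^sub>v b + p) = A *\<^sub>v (pinv A *\<^sub>v b)"
    using A X b p by (simp add: mult_add_distrib_mat_vec[of _ m n])
  then show ?thesis
    unfolding pinv_normal_equations[OF A b] proj_mat_kernel[OF A x0] p_def[symmetric]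
    using X b p pinv_residual[OF A b] by (intro least_squares_is_arg_min[OF A b]) simp_all
qed

text \<open>The projection contributes \<open>x0\<close> itself, which cancels; what remains lies in
  the range of \<open>pinv A\<close>.\<close>

lemma minus_kernel_shifted_pinv:
  assumes A: "A \<in> carrier_mat m n" and b: "b \<in> carrier_vec m" and x0: "x0 \<in> carrier_vec n"
  shows "x0 - (pinv (A\<^sup>T * A) *\<^sub>v (A\<^sup>T *\<^sub>v b) + proj (mat_kernel A) x0) = pinv A *\<^sub>v (A *\<^sub>v x0 - b)"
proof -
  note X = pinv_carrier[OF A]
  show ?thesis
    unfolding pinv_normal_equations[OF A b] proj_mat_kernel[OF A x0]
      mult_minus_distrib_mat_vec[OF X mult_mat_vec_carrier[OF A x0] b]
    using X x0 by (intro eq_vecI) simp_all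
qed

text \<open>The vector \<open>b\<close> is \<open>r\<close> plus an element of the range of
  \<open>A\<close>, to which \<open>r\<close> is orthogonal. This turns the slope of the gap into a
  sum of squares.\<close>

lemma scalar_residual:
  assumes A: "A \<in> carrier_mat m n" and b: "b \<in> carrier_vec m"
  defines "r \<equiv> b - A *\<^sub>v (pinv (A\<^sup>T * A) *\<^sub>v (A\<^sup>T *\<^sub>v b))"
  shows "b \<bullet> r = r \<bullet> r"
proof -
  note X = pinv_carrier[OF A]
  define w where "w = pinv A *\<^sub>v b"
  have w: "w \<in> carrier_vec n" using X b by (simp add: w_def)
  have r_eq: "r = b - A *\<^sub>v w" by (simp add: r_def w_def pinv_normal_equations[OF A b])
  have Aw: "A *\<^sub>v w \<in> carrier_vec m" using A w by simp
  have r: "r \<in> carrier_vec m" unfolding r_eq using b Aw by (rule minus_carrier_vec)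
  have "A *\<^sub>v w - b = - r" using A b unfolding r_eq by (intro eq_vecI) auto
  then have "A\<^sup>T *\<^sub>v (- r) = 0\<^sub>v n" using pinv_residual[OF A b] by (simp add: w_def)
  moreover have "(- r) \<bullet> (A *\<^sub>v w) = (A\<^sup>T *\<^sub>v (- r)) \<bullet> w"
    using mult_transpose_scalar[OF A w, of "- r"] r by simp
  ultimately have "r \<bullet> (A *\<^sub>v w) = 0" using uminus_scalar_prod[OF r Aw] w by simp
  then have 0: "(A *\<^sub>v w) \<bullet> r = 0" using comm_scalar_prod[OF Aw r] by simp
  have "r \<bullet> r = b \<bullet> r - (A *\<^sub>v w) \<bullet> r"
    using minus_scalar_prod_distrib[OF b Aw r] by (simp only: r_eq[symmetric])
  then show ?thesis using 0 by simp
qed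

text \<open>A phase may begin after index 0, so the dimensions of its initial point come from
  induction along the iteration.\<close>

lemma pdhg_iterates_carrier:
  assumes A: "A \<in> carrier_mat m n" and c: "c \<in> carrier_vec n" and z: "pdhg_iterates A b c \<eta> z"
  shows "z k \<in> nonneg_orthant n \<times> carrier_vec m"
proof (induction k)
  case 0
  then show ?case using z A by (simp add: pdhg_iterates_def)
next
  case (Suc k)
  obtain x y where xy: "z k = (x, y)" by (cases "z k")
  define v where "v = x - \<eta> \<cdot>\<^sub>v (c - A\<^sup>T *\<^sub>v y)"
  have v: "v \<in> carrier_vec n" using A by (intro carrier_vecI) (simp add: v_def)
  have "z (Suc k) = pdhg_step A b c \<eta> (x, y)" using z by (simp add: pdhg_iterates_def xy)
  then have "fst (z (Suc k)) = proj (nonneg_orthant n) v" "dim_vec (snd (z (Suc k))) = m"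
    using A by (simp_all add: pdhg_step_def Let_def v_def)
  then show ?case
    unfolding proj_nonneg_orthant[OF v]
    by (auto simp: mem_Times_iff nonneg_orthant_def intro: carrier_vecI)
qed

lemma linear_antimono_on:
  fixes a s :: real
  assumes "s \<le> 0"
  shows "antimono_on S (\<lambda>\<theta>. a + \<theta> * s)"
  using assms by (intro monotone_onI) (simp add: mult_right_mono_neg)

lemma linear_strict_antimono_on:
  fixes a s :: real
  assumes "s < 0"
  shows "strict_antimono_on S (\<lambda>\<theta>. a + \<theta> * s)"
  using assms by (intro monotone_onI) simp

text \<open>The gap is affine in \<open>\<theta>\<close>, so the sign of the slope decides its
  monotonicity.\<close>

lemma duality_gap_along_ray:
  assumes "c \<in> carrier_vec n" "x \<in> carrier_vec n" "u \<in> carrier_vec n"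
    and "b \<in> carrier_vec m" "y \<in> carrier_vec m" "v \<in> carrier_vec m"
  shows "duality_gap b c (x + \<theta> \<cdot>\<^sub>v u) (y + \<theta> \<cdot>\<^sub>v v) = duality_gap b c x y + \<theta> * (c \<bullet> u - b \<bullet> v)"
  using assms
  by (simp add: duality_gap_def scalar_prod_add_distrib[of _ n] scalar_prod_add_distrib[of _ m] algebra_simps)

text \<open>The step size bound is written as a product so that it keeps its meaning when
  \<open>spectral_norm A\<close> is 0. Convergence to the zero vector is expressed by the
  norm.\<close>

theorem proposition8:
  fixes m n :: nat and A :: "real mat" and b c :: "real vec" and \<eta> :: real
    and B N :: "nat set" and z :: "nat \<Rightarrow> real vec \<times> real vec" and s :: nat and e :: enat
    and x0 y0 :: "real vec"
  assumes A: "A \<in> carrier_mat m n"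
    and b: "b \<in> carrier_vec m"
    and c: "c \<in> carrier_vec n"
    and eta: "0 < \<eta>" "\<eta> * spectral_norm A < 1"
    and phase: "pdhg_phase A b c \<eta> B N z s e"
    and init: "z s = (x0, y0)"
  shows "let A_B = sub_cols A B; c_B = sub_vec c B; P_B = P_mat A \<eta> B;
             x_v = center_x A b B x0; y_v = center_y A c B y0;
             v_x = ray_x A c \<eta> B; v_y = ray_y A b \<eta> B;
             gap = (\<lambda>\<theta>. duality_gap b c (x_v + \<theta> \<cdot>\<^sub>v v_x) (y_v + \<theta> \<cdot>\<^sub>v v_y))
         in (\<lambda>k. l2_norm ((P_B ^\<^sub>m k) *\<^sub>v ((sub_vec x0 B - sub_vec x_v B) @\<^sub>v (y0 - y_v))))
              \<longlonglongrightarrow> 0 \<and>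
            is_arg_min (\<lambda>x_B. l2_norm (A_B *\<^sub>v x_B - b)) (\<lambda>x_B. x_B \<in> carrier_vec (card B))
              (sub_vec x_v B) \<and>
            is_arg_min (\<lambda>y. l2_norm (A_B\<^sup>T *\<^sub>v y - c_B)) (\<lambda>y. y \<in> carrier_vec m) y_v \<and>
            antimono_on {0..} gap \<and>
            c \<bullet> v_x - b \<bullet> v_y \<le> 0 \<and>
            ((v_x, v_y) \<noteq> (0\<^sub>v n, 0\<^sub>v m) \<longrightarrow>
               strict_antimono_on {0..} gap \<and> c \<bullet> v_x - b \<bullet> v_y < 0)"
proof -
  have "z s \<in> nonneg_orthant n \<times> carrier_vec m"
    using A c phase by (intro pdhg_iterates_carrier) (auto simp: pdhg_phase_def)
  then have x0: "x0 \<in> carrier_vec n" and y0: "y0 \<in> carrier_vec m"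
    by (auto simp: init nonneg_orthant_def)
  \<comment> \<open>The basis is read off at index \<open>s\<close>, which belongs to the
    phase.\<close>
  have B: "B \<subseteq> {..<n}"
    using phase A by (auto simp: pdhg_phase_def pdhg_basis_def init dest!: spec[of _ s])
  define p where "p = card B"
  define K where "K = sub_cols A B"
  define c_B where "c_B = sub_vec c B"
  define x_B where "x_B = sub_vec x0 B"
  define x_v where "x_v = center_x A b B x0"
  define y_v where "y_v = center_y A c B y0"
  define v_x where "v_x = ray_x A c \<eta> B"
  define v_y where "v_y = ray_y A b \<eta> B"
  define \<xi> where "\<xi> = pinv (K\<^sup>T * K) *\<^sub>v (K\<^sup>T *\<^sub>v b) + proj (mat_kernel K) x_B"
  have K: "K \<in> carrier_mat m p" unfolding K_def p_def using A B by (rule sub_cols_carrier)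
  then have Kt: "K\<^sup>T \<in> carrier_mat p m" by simp
  have cB: "c_B \<in> carrier_vec p" and xB: "x_B \<in> carrier_vec p"
    using c x0 B by (auto simp: c_B_def x_B_def p_def sub_vec_def Collect_less_mem_eq intro!: carrier_vecI)

  \<comment> \<open>Least-squares property of the spiral center\<close>
  have min_x: "is_arg_min (\<lambda>x. l2_norm (K *\<^sub>v x - b)) (\<lambda>x. x \<in> carrier_vec p) \<xi>"
    unfolding \<xi>_def using K b xB by (rule kernel_shifted_pinv_is_arg_min)
  then have \<xi>: "\<xi> \<in> carrier_vec p" by (simp add: is_arg_min_def)
  have x_v_eq: "x_v = extend_vec n B \<xi>"
    using A by (simp add: x_v_def center_x_def Let_def \<xi>_def K_def x_B_def)
  have sub_x_v: "sub_vec x_v B = \<xi>"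
    unfolding x_v_eq using \<xi> B by (intro sub_vec_extend_vec) (simp add: Collect_less_mem_eq p_def)
  \<comment> \<open>Double transposes put the dual center into the primal form, with
    \<open>K\<^sup>T\<close> and \<open>c_B\<close> in place of \<open>K\<close> and
    \<open>b\<close>.\<close>
  have y_v_eq: "y_v = pinv (K\<^sup>T\<^sup>T * K\<^sup>T) *\<^sub>v (K\<^sup>T\<^sup>T *\<^sub>v c_B) + proj (mat_kernel K\<^sup>T) y0"
    by (simp add: y_v_def center_y_def Let_def K_def c_B_def)
  have min_y: "is_arg_min (\<lambda>y. l2_norm (K\<^sup>T *\<^sub>v y - c_B)) (\<lambda>y. y \<in> carrier_vec m) y_v"
    unfolding y_v_eq using Kt cB y0 by (rule kernel_shifted_pinv_is_arg_min)
  then have y_v: "y_v \<in> carrier_vec m" by (simp add: is_arg_min_def)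

  \<comment> \<open>Decay of the rotation component\<close>
  define L where "L = \<eta> \<cdot>\<^sub>m K"
  have L: "L \<in> carrier_mat m p" using K by (simp add: L_def)
  have Lt: "L\<^sup>T = \<eta> \<cdot>\<^sub>m K\<^sup>T" unfolding L_def using K by (intro eq_matI) auto
  define f where "f = (\<lambda>(x, y). (x + L\<^sup>T *\<^sub>v y, y - (L *\<^sub>v x + 2 \<cdot>\<^sub>v (L *\<^sub>v (L\<^sup>T *\<^sub>v y)))))"
  define x where "x k = fst ((f ^^ k) (x_B - \<xi>, y0 - y_v))" for k
  define y where "y k = snd ((f ^^ k) (x_B - \<xi>, y0 - y_v))" for k
  have Suc: "x (Suc k) = x k + L\<^sup>T *\<^sub>v y k" "y (Suc k) = y k - (L *\<^sub>v x k + 2 \<cdot>\<^sub>v (L *\<^sub>v (L\<^sup>T *\<^sub>v y k)))" for k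
    by (simp_all add: x_def y_def f_def case_prod_unfold)
  have P: "P_mat A \<eta> B \<in> carrier_mat (p + m) (p + m)"
    unfolding P_mat_def Let_def K_def[symmetric] using K by (intro four_block_carrier_mat) auto
  \<comment> \<open>The starting vectors are generalized because the power is unfolded with its
    first factor acting on them, so the induction hypothesis is used at their image.\<close>
  have powers: "P_mat A \<eta> B ^\<^sub>m k *\<^sub>v (u @\<^sub>v w) = (case (f ^^ k) (u, w) of (u', w') \<Rightarrow> u' @\<^sub>v w')"
    if "u \<in> carrier_vec p" "w \<in> carrier_vec m" for k u w
    using that
  proof (induction k arbitrary: u w)
    case 0
    then show ?case using P by simp
  next
    case (Suc k)
    obtain u' w' where f: "f (u, w) = (u', w')" by (cases "f (u, w)")
    have u'w': "u' \<in> carrier_vec p" "w' \<in> carrier_vec m"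
      using f L Suc.prems by (auto simp: f_def intro!: carrier_vecI)
    have "P_mat A \<eta> B ^\<^sub>m Suc k *\<^sub>v (u @\<^sub>v w) = P_mat A \<eta> B ^\<^sub>m k *\<^sub>v (P_mat A \<eta> B *\<^sub>v (u @\<^sub>v w))"
      using P Suc.prems by (simp add: mult_mat_vec_assoc_dim)
    also have "P_mat A \<eta> B *\<^sub>v (u @\<^sub>v w) = u' @\<^sub>v w'"
      using f P_mat_mult_vec[OF A B, of u w \<eta>] Suc.prems
      by (simp add: f_def p_def L_def K_def)
    finally show ?case using Suc.IH[OF u'w'] f by (simp add: funpow_swap1)
  qed
  \<comment> \<open>The preimages come from \<open>pinv_range\<close>; the factor
    \<open>1 / \<eta>\<close> compensates for the step size inside \<open>L\<close>.\<close>
  have start: "x 0 = L\<^sup>T *\<^sub>v ((1 / \<eta>) \<cdot>\<^sub>v ((pinv K)\<^sup>T *\<^sub>v (pinv K *\<^sub>v (K *\<^sub>v x_B - b))))"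
    "y 0 = L *\<^sub>v ((1 / \<eta>) \<cdot>\<^sub>v ((pinv K\<^sup>T)\<^sup>T *\<^sub>v (pinv K\<^sup>T *\<^sub>v (K\<^sup>T *\<^sub>v y0 - c_B))))"
  proof -
    have r: "K *\<^sub>v x_B - b \<in> carrier_vec m" "K\<^sup>T *\<^sub>v y0 - c_B \<in> carrier_vec p"
      using K b cB by (auto intro!: carrier_vecI)
    have scale: "(\<eta> \<cdot>\<^sub>m M) *\<^sub>v ((1 / \<eta>) \<cdot>\<^sub>v v) = M *\<^sub>v v" if "dim_vec v = dim_col M" for M :: "real mat" and v
      using that eta by (simp add: smult_mat_mult_vec mult_mat_smult_vec
          smult_smult_assoc)
    show "x 0 = L\<^sup>T *\<^sub>v ((1 / \<eta>) \<cdot>\<^sub>v ((pinv K)\<^sup>T *\<^sub>v (pinv K *\<^sub>v (K *\<^sub>v x_B - b))))"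
      unfolding x_def \<xi>_def using pinv_range[OF K r(1)] minus_kernel_shifted_pinv[OF K b xB] pinv_carrier[OF K] K
      by (simp add: Lt scale)
    show "y 0 = L *\<^sub>v ((1 / \<eta>) \<cdot>\<^sub>v ((pinv K\<^sup>T)\<^sup>T *\<^sub>v (pinv K\<^sup>T *\<^sub>v (K\<^sup>T *\<^sub>v y0 - c_B))))"
      unfolding y_def y_v_eq L_def
      using pinv_range[OF Kt r(2)] minus_kernel_shifted_pinv[OF Kt cB y0] pinv_carrier[OF Kt] K
      by (simp add: scale)
  qed
  have start_carrier: "(1 / \<eta>) \<cdot>\<^sub>v ((pinv K)\<^sup>T *\<^sub>v (pinv K *\<^sub>v (K *\<^sub>v x_B - b))) \<in> carrier_vec m"
    "(1 / \<eta>) \<cdot>\<^sub>v ((pinv K\<^sup>T)\<^sup>T *\<^sub>v (pinv K\<^sup>T *\<^sub>v (K\<^sup>T *\<^sub>v y0 - c_B))) \<in> carrier_vec p"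
    using pinv_carrier[OF K] pinv_carrier[OF Kt] by (intro carrier_vecI; simp)+
  have bound: "l2_norm (L *\<^sub>v v) \<le> \<eta> * spectral_norm A * l2_norm v" if "v \<in> carrier_vec p" for v
  proof -
    have "l2_norm (L *\<^sub>v v) = \<eta> * l2_norm (K *\<^sub>v v)"
      using K that eta by (simp add: L_def smult_mat_mult_vec l2_norm_smult)
    then show ?thesis
      using l2_norm_sub_cols_mult_le[OF A B, of v] that eta by (simp add: K_def p_def)
  qed
  have "0 \<le> spectral_norm A"
    unfolding spectral_norm_def
    by (rule cSUP_upper2[OF bdd_above_spectral_norm, of "0\<^sub>v (dim_col A)"])
      (auto simp: l2_norm_nonneg, simp add: l2_norm_def)
  then have q: "0 \<le> \<eta> * spectral_norm A" using eta by simp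
  have x_y_0: "(\<lambda>k. l2_norm (x k)) \<longlonglongrightarrow> 0" "(\<lambda>k. l2_norm (y k)) \<longlonglongrightarrow> 0"
    by (rule rotation_tendsto_0[OF L q eta(2) bound start_carrier(1) start(1) start_carrier(2) start(2) Suc]; assumption)+
  have "l2_norm (P_mat A \<eta> B ^\<^sub>m k *\<^sub>v ((x_B - \<xi>) @\<^sub>v (y0 - y_v))) = sqrt ((l2_norm (x k))\<^sup>2 + (l2_norm (y k))\<^sup>2)" for k
  proof -
    have "P_mat A \<eta> B ^\<^sub>m k *\<^sub>v ((x_B - \<xi>) @\<^sub>v (y0 - y_v)) = x k @\<^sub>v y k"
      using powers[of "x_B - \<xi>" "y0 - y_v" k] xB \<xi> y0 y_v by (simp add: x_def y_def case_prod_unfold)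
    then show ?thesis
      by (simp add: l2_norm_sq scalar_prod_append[of _ "dim_vec (x k)" _ "dim_vec (y k)"] l2_norm_def[of "_ @\<^sub>v _"])
  qed
  moreover have "(\<lambda>k. sqrt ((l2_norm (x k))\<^sup>2 + (l2_norm (y k))\<^sup>2)) \<longlonglongrightarrow> 0"
    using tendsto_real_sqrt[OF tendsto_add[OF tendsto_power[OF x_y_0(1), of 2] tendsto_power[OF x_y_0(2), of 2]]]
    by simp
  ultimately have lim: "(\<lambda>k. l2_norm (P_mat A \<eta> B ^\<^sub>m k *\<^sub>v ((x_B - \<xi>) @\<^sub>v (y0 - y_v)))) \<longlonglongrightarrow> 0"
    by simp

  \<comment> \<open>Slope of the duality gap along the ray\<close>
  define r where "r = b - K *\<^sub>v (pinv (K\<^sup>T * K) *\<^sub>v (K\<^sup>T *\<^sub>v b))"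
  define r' where "r' = c_B - K\<^sup>T *\<^sub>v (pinv (K * K\<^sup>T) *\<^sub>v (K *\<^sub>v c_B))"
  have r: "r \<in> carrier_vec m" and r': "r' \<in> carrier_vec p"
    using K by (auto intro!: carrier_vecI simp: r_def r'_def)
  have v_y_eq: "v_y = \<eta> \<cdot>\<^sub>v r" by (simp add: v_y_def ray_y_def Let_def r_def K_def)
  have v_x_eq: "v_x = extend_vec n B (- (\<eta> \<cdot>\<^sub>v r'))"
    using A by (simp add: v_x_def ray_x_def Let_def r'_def K_def c_B_def)
  have b_r: "b \<bullet> r = r \<bullet> r" unfolding r_def using K b by (rule scalar_residual)
  have c_r': "c_B \<bullet> r' = r' \<bullet> r'"
    using scalar_residual[OF Kt cB] by (simp add: r'_def)
  have "c \<bullet> v_x = c_B \<bullet> (- (\<eta> \<cdot>\<^sub>v r'))"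
    unfolding v_x_eq c_B_def using B c r' by (intro scalar_prod_extend_vec) (simp_all add: p_def)
  also have "\<dots> = - (\<eta> * (r' \<bullet> r'))" using cB r' by (simp add: c_r')
  finally have slope: "c \<bullet> v_x - b \<bullet> v_y = - (\<eta> * (r' \<bullet> r' + r \<bullet> r))"
    using b r by (simp add: v_y_eq b_r algebra_simps)
  have slope_le: "c \<bullet> v_x - b \<bullet> v_y \<le> 0"
    unfolding slope using eta scalar_self_nonneg[of r] scalar_self_nonneg[of r'] by simp
  have slope_less: "c \<bullet> v_x - b \<bullet> v_y < 0" if "(v_x, v_y) \<noteq> (0\<^sub>v n, 0\<^sub>v m)"
  proof (rule ccontr)
    assume "\<not> c \<bullet> v_x - b \<bullet> v_y < 0"
    then have "r' \<bullet> r' + r \<bullet> r \<le> 0" unfolding slope using eta by (simp add: not_less mult_le_0_iff)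
    then have "r \<bullet> r = 0" "r' \<bullet> r' = 0"
      using scalar_self_nonneg[of r] scalar_self_nonneg[of r'] by linarith+
    then have r0: "r = 0\<^sub>v m" "r' = 0\<^sub>v p" using r r' scalar_self_eq_0_iff by auto
    have "v_y = 0\<^sub>v m" unfolding v_y_eq r0 by auto
    moreover have "v_x = 0\<^sub>v n"
    proof -
      \<comment> \<open>The squared norm of \<open>v_x\<close> is computed on the coordinates in
        \<open>B\<close>, where \<open>v_x\<close> is a multiple of the vanishing
        \<open>r'\<close>.\<close>
      have "v_x \<bullet> v_x = sub_vec v_x B \<bullet> (- (\<eta> \<cdot>\<^sub>v r'))"
        unfolding v_x_eq using B r' by (intro scalar_prod_extend_vec) (simp_all add: p_def extend_vec_def)
      also have "sub_vec v_x B = - (\<eta> \<cdot>\<^sub>v r')"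
        unfolding v_x_eq using B r' by (intro sub_vec_extend_vec) (simp add: Collect_less_mem_eq p_def)
      also have "(- (\<eta> \<cdot>\<^sub>v r')) \<bullet> (- (\<eta> \<cdot>\<^sub>v r')) = 0" using r' unfolding r0 by simp
      finally show ?thesis using scalar_self_eq_0_iff[of v_x] by (simp add: v_x_eq extend_vec_def)
    qed
    ultimately show False using that by simp
  qed
  have gap_eq: "(\<lambda>\<theta>. duality_gap b c (x_v + \<theta> \<cdot>\<^sub>v v_x) (y_v + \<theta> \<cdot>\<^sub>v v_y)) =
      (\<lambda>\<theta>. duality_gap b c x_v y_v + \<theta> * (c \<bullet> v_x - b \<bullet> v_y))"
    using b c y_v r by (intro ext duality_gap_along_ray[of _ n _ _ _ m])
      (simp_all add: x_v_eq v_x_eq v_y_eq extend_vec_def)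
  show ?thesis
    unfolding Let_def x_v_def[symmetric] y_v_def[symmetric] v_x_def[symmetric] v_y_def[symmetric]
      K_def[symmetric] c_B_def[symmetric] x_B_def[symmetric] p_def[symmetric] sub_x_v gap_eq
    using lim min_x min_y slope_le slope_less linear_antimono_on linear_strict_antimono_on by blast
qed

end
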